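(* Let $\mathsf{C}$ be a category such that for every monad $\mathscr{T}$ on $\mathsf{C}$ the category $\mathsf{C}^{\mathscr{T}}$ of $\mathscr{T}$-algebras has coequalizers of all reflexive pairs. Let $\mathscr{M}$ and $\mathscr{N}$ be monads on $\mathsf{C}$ and let $\phi\colon\mathscr{M}\to\mathscr{N}$ be a natural transformation of monads. Then the datum $(\mathscr{M},\mathscr{N},\phi)$ has the PBW property if and only if $\mathscr{N}$, regarded as a right $\mathscr{M}$-module via $\phi$, is a free right $\mathscr{M}$-module.
   Context: A monad on $\mathsf{C}$ is a monoid $(\mathscr{M},\mu_{\mathscr{M}},\eta_{\mathscr{M}})$ in the strict monoidal category of endofunctors of $\mathsf{C}$ under composition $\circ$, with unit the identity functor; a natural transformation of monads is a morphism of such monoids. $\mathsf{C}^{\mathscr{M}}$ denotes the category of algebras over $\mathscr{M}$, i.e. objects $c$ with a structure map $\gamma_c\colon\mathscr{M}(c)\to c$ satisfying the usual associativity and unit axioms. A reflexive pair is a pair of parallel arrows $f,g\colon c_1\to c_2$ for which there is an arrow $d\colon c_2\to c_1$ with $fd=gd=1_{c_2}$. A right module over $\mathscr{M}$ is an endofunctor $\mathscr{R}$ of $\mathsf{C}$ with a natural transformation $\rho\colon\mathscr{R}\circ\mathscr{M}\to\mathscr{R}$ satisfying the usual associativity and unit axioms. The free right $\mathscr{M}$-module generated by an endofunctor $\mathscr{X}$ is $\mathscr{X}\circ\mathscr{M}$ with structure map $1_{\mathscr{X}}\circ\mu_{\mathscr{M}}$; a right $\mathscr{M}$-module is free if it is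 isomorphic, as a right $\mathscr{M}$-module, to $\mathscr{X}\circ\mathscr{M}$ for some endofunctor $\mathscr{X}$ of $\mathsf{C}$. Via $\phi$, the endofunctor $\mathscr{N}$ is a right $\mathscr{M}$-module with structure map the composite $\mathscr{N}\circ\mathscr{M}\xrightarrow{1_{\mathscr{N}}\circ\phi}\mathscr{N}\circ\mathscr{N}\xrightarrow{\mu_{\mathscr{N}}}\mathscr{N}$. The functor of change of algebra structure $\phi^*\colon\mathsf{C}^{\mathscr{N}}\to\mathsf{C}^{\mathscr{M}}$ sends an $\mathscr{N}$-algebra $c$ to the same object with structure map $\mathscr{M}(c)\xrightarrow{\phi_c}\mathscr{N}(c)\xrightarrow{\gamma_c}c$. Under the assumption on $\mathsf{C}$ it has a left adjoint $\phi_!\colon\mathsf{C}^{\mathscr{M}}\to\mathsf{C}^{\mathscr{N}}$; $\phi_!(c)$ is called the universal enveloping $\mathscr{N}$-algebra of $c$. The datum $(\mathscr{M},\mathscr{N},\phi)$ has the PBW property if there exists an endofunctor $\mathscr{X}$ of $\mathsf{C}$ such that, for every $\mathscr{M}$-algebra $c$, the underlying object of $\phi_!(c)$ is isomorphic to $\mathscr{X}(c)$ ($\mathscr{X}$ applied to the underlying object of $c$), naturally with respect to morphisms in $\mathsf{C}^{\mathscr{M}}$. *)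

theory Defs
  imports Main
begin

section \<open>Categories\<close>

record ('o, 'm) cat =
  Obj :: "'o set"
  Arr :: "'m set"
  Dom :: "'m \<Rightarrow> 'o"
  Cod :: "'m \<Rightarrow> 'o"
  Ident :: "'o \<Rightarrow> 'm"
  Comp :: "'m \<Rightarrow> 'm \<Rightarrow> 'm"  (infixr "\<cdot>\<index>" 70)

definition Hom :: "('o, 'm) cat \<Rightarrow> 'o \<Rightarrow> 'o \<Rightarrow> 'm set" where
  "Hom C a b = {f \<in> Arr C. Dom C f = a \<and> Cod C f = b}"

definition category :: "('o, 'm) cat \<Rightarrow> bool" where
  "category C \<longleftrightarrow>
     (\<forall>f\<in>Arr C. Dom C f \<in> Obj C \<and> Cod C f \<in> Obj C) \<and>
     (\<forall>a\<in>Obj C. Ident C a \<in> Hom C a a) \<and>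
     (\<forall>a b c. \<forall>f\<in>Hom C a b. \<forall>g\<in>Hom C b c. g \<cdot>\<^bsub>C\<^esub> f \<in> Hom C a c) \<and>
     (\<forall>a b. \<forall>f\<in>Hom C a b. Ident C b \<cdot>\<^bsub>C\<^esub> f = f \<and> f \<cdot>\<^bsub>C\<^esub> Ident C a = f) \<and>
     (\<forall>a b c d. \<forall>f\<in>Hom C a b. \<forall>g\<in>Hom C b c. \<forall>h\<in>Hom C c d.
        (h \<cdot>\<^bsub>C\<^esub> g) \<cdot>\<^bsub>C\<^esub> f = h \<cdot>\<^bsub>C\<^esub> (g \<cdot>\<^bsub>C\<^esub> f))"

definition is_iso :: "('o, 'm) cat \<Rightarrow> 'o \<Rightarrow> 'o \<Rightarrow> 'm \<Rightarrow> bool" where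
  "is_iso C a b f \<longleftrightarrow> f \<in> Hom C a b \<and>
     (\<exists>g\<in>Hom C b a. g \<cdot>\<^bsub>C\<^esub> f = Ident C a \<and> f \<cdot>\<^bsub>C\<^esub> g = Ident C b)"

definition reflexive_pair :: "('o, 'm) cat \<Rightarrow> 'o \<Rightarrow> 'o \<Rightarrow> 'm \<Rightarrow> 'm \<Rightarrow> bool" where
  "reflexive_pair C a b f g \<longleftrightarrow> f \<in> Hom C a b \<and> g \<in> Hom C a b \<and>
     (\<exists>d\<in>Hom C b a. f \<cdot>\<^bsub>C\<^esub> d = Ident C b \<and> g \<cdot>\<^bsub>C\<^esub> d = Ident C b)"

definition is_coequalizer ::
    "('o, 'm) cat \<Rightarrow> 'o \<Rightarrow> 'o \<Rightarrow> 'm \<Rightarrow> 'm \<Rightarrow> 'o \<Rightarrow> 'm \<Rightarrow> bool" where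
  "is_coequalizer C a b f g e q \<longleftrightarrow>
     f \<in> Hom C a b \<and> g \<in> Hom C a b \<and> q \<in> Hom C b e \<and> q \<cdot>\<^bsub>C\<^esub> f = q \<cdot>\<^bsub>C\<^esub> g \<and>
     (\<forall>z. \<forall>h\<in>Hom C b z. h \<cdot>\<^bsub>C\<^esub> f = h \<cdot>\<^bsub>C\<^esub> g \<longrightarrow>
        (\<exists>!k. k \<in> Hom C e z \<and> k \<cdot>\<^bsub>C\<^esub> q = h))"

definition has_reflexive_coequalizers :: "('o, 'm) cat \<Rightarrow> bool" where
  "has_reflexive_coequalizers C \<longleftrightarrow>
     (\<forall>a b f g. reflexive_pair C a b f g \<longrightarrow> (\<exists>e q. is_coequalizer C a b f g e q))"


section \<open>Functors, natural transformations, adjunctions\<close>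

record ('o, 'm, 'p, 'n) functor_data =
  on_obj :: "'o \<Rightarrow> 'p"
  on_arr :: "'m \<Rightarrow> 'n"

definition is_functor ::
    "('o, 'm) cat \<Rightarrow> ('p, 'n) cat \<Rightarrow> ('o, 'm, 'p, 'n) functor_data \<Rightarrow> bool" where
  "is_functor C D F \<longleftrightarrow>
     (\<forall>a\<in>Obj C. on_obj F a \<in> Obj D) \<and>
     (\<forall>a b. \<forall>f\<in>Hom C a b. on_arr F f \<in> Hom D (on_obj F a) (on_obj F b)) \<and>
     (\<forall>a\<in>Obj C. on_arr F (Ident C a) = Ident D (on_obj F a)) \<and>
     (\<forall>a b c. \<forall>f\<in>Hom C a b. \<forall>g\<in>Hom C b c.
        on_arr F (g \<cdot>\<^bsub>C\<^esub> f) = on_arr F g \<cdot>\<^bsub>D\<^esub> on_arr F f)"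

abbreviation is_endofunctor :: "('o, 'm) cat \<Rightarrow> ('o, 'm, 'o, 'm) functor_data \<Rightarrow> bool" where
  "is_endofunctor C F \<equiv> is_functor C C F"

definition id_functor :: "('o, 'm, 'o, 'm) functor_data" where
  "id_functor = \<lparr>on_obj = (\<lambda>a. a), on_arr = (\<lambda>f. f)\<rparr>"

definition comp_functor ::
    "('p, 'n, 'q, 'k) functor_data \<Rightarrow> ('o, 'm, 'p, 'n) functor_data \<Rightarrow> ('o, 'm, 'q, 'k) functor_data"
    (infixr "\<odot>" 75) where
  "G \<odot> F = \<lparr>on_obj = (\<lambda>a. on_obj G (on_obj F a)), on_arr = (\<lambda>f. on_arr G (on_arr F f))\<rparr>"

text \<open>A natural transformation is given by its family of components; only the components at
  objects of the source category are meaningful.\<close>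

definition nat_trans ::
    "('o, 'm) cat \<Rightarrow> ('p, 'n) cat \<Rightarrow> ('o, 'm, 'p, 'n) functor_data \<Rightarrow> ('o, 'm, 'p, 'n) functor_data
      \<Rightarrow> ('o \<Rightarrow> 'n) \<Rightarrow> bool" where
  "nat_trans C D F G \<tau> \<longleftrightarrow>
     (\<forall>a\<in>Obj C. \<tau> a \<in> Hom D (on_obj F a) (on_obj G a)) \<and>
     (\<forall>a b. \<forall>f\<in>Hom C a b. \<tau> b \<cdot>\<^bsub>D\<^esub> on_arr F f = on_arr G f \<cdot>\<^bsub>D\<^esub> \<tau> a)"

definition nat_iso ::
    "('o, 'm) cat \<Rightarrow> ('p, 'n) cat \<Rightarrow> ('o, 'm, 'p, 'n) functor_data \<Rightarrow> ('o, 'm, 'p, 'n) functor_data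
      \<Rightarrow> ('o \<Rightarrow> 'n) \<Rightarrow> bool" where
  "nat_iso C D F G \<tau> \<longleftrightarrow>
     nat_trans C D F G \<tau> \<and> (\<forall>a\<in>Obj C. is_iso D (on_obj F a) (on_obj G a) (\<tau> a))"

definition left_adjoint ::
    "('o, 'm) cat \<Rightarrow> ('p, 'n) cat \<Rightarrow> ('o, 'm, 'p, 'n) functor_data \<Rightarrow> ('p, 'n, 'o, 'm) functor_data
      \<Rightarrow> bool" where
  "left_adjoint C D F G \<longleftrightarrow> is_functor C D F \<and> is_functor D C G \<and>
     (\<exists>\<eta> \<epsilon>. nat_trans C C id_functor (G \<odot> F) \<eta> \<and> nat_trans D D (F \<odot> G) id_functor \<epsilon> \<and>
        (\<forall>a\<in>Obj C. \<epsilon> (on_obj F a) \<cdot>\<^bsub>D\<^esub> on_arr F (\<eta> a) = Ident D (on_obj F a)) \<and>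
        (\<forall>b\<in>Obj D. on_arr G (\<epsilon> b) \<cdot>\<^bsub>C\<^esub> \<eta> (on_obj G b) = Ident C (on_obj G b)))"


section \<open>Monads and their algebras\<close>

record ('o, 'm) monad_data =
  endo :: "('o, 'm, 'o, 'm) functor_data"
  mult :: "'o \<Rightarrow> 'm"
  eta :: "'o \<Rightarrow> 'm"

definition monad :: "('o, 'm) cat \<Rightarrow> ('o, 'm) monad_data \<Rightarrow> bool" where
  "monad C T \<longleftrightarrow> is_endofunctor C (endo T) \<and>
     nat_trans C C (endo T \<odot> endo T) (endo T) (mult T) \<and>
     nat_trans C C id_functor (endo T) (eta T) \<and>
     (\<forall>a\<in>Obj C.
        mult T a \<cdot>\<^bsub>C\<^esub> mult T (on_obj (endo T) a) = mult T a \<cdot>\<^bsub>C\<^esub> on_arr (endo T) (mult T a) \<and>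
        mult T a \<cdot>\<^bsub>C\<^esub> eta T (on_obj (endo T) a) = Ident C (on_obj (endo T) a) \<and>
        mult T a \<cdot>\<^bsub>C\<^esub> on_arr (endo T) (eta T a) = Ident C (on_obj (endo T) a))"

text \<open>In the multiplicativity axiom, the composite of the last two arrows on the right is the
  component at \<open>a\<close> of the horizontal composite of \<open>\<phi>\<close> with itself.\<close>

definition monad_morphism ::
    "('o, 'm) cat \<Rightarrow> ('o, 'm) monad_data \<Rightarrow> ('o, 'm) monad_data \<Rightarrow> ('o \<Rightarrow> 'm) \<Rightarrow> bool" where
  "monad_morphism C M N \<phi> \<longleftrightarrow> nat_trans C C (endo M) (endo N) \<phi> \<and>
     (\<forall>a\<in>Obj C.
        \<phi> a \<cdot>\<^bsub>C\<^esub> mult M a = mult N a \<cdot>\<^bsub>C\<^esub> on_arr (endo N) (\<phi> a) \<cdot>\<^bsub>C\<^esub> \<phi> (on_obj (endo M) a) \<and>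
        \<phi> a \<cdot>\<^bsub>C\<^esub> eta M a = eta N a)"

definition is_algebra :: "('o, 'm) cat \<Rightarrow> ('o, 'm) monad_data \<Rightarrow> 'o \<times> 'm \<Rightarrow> bool" where
  "is_algebra C T = (\<lambda>(c, \<gamma>).
     c \<in> Obj C \<and> \<gamma> \<in> Hom C (on_obj (endo T) c) c \<and>
     \<gamma> \<cdot>\<^bsub>C\<^esub> mult T c = \<gamma> \<cdot>\<^bsub>C\<^esub> on_arr (endo T) \<gamma> \<and>
     \<gamma> \<cdot>\<^bsub>C\<^esub> eta T c = Ident C c)"

text \<open>An algebra morphism is stored together with its source and target, since one arrow of \<open>C\<close> may
  underlie morphisms between different pairs of algebras.\<close>

type_synonym ('o, 'm) alg_arr = "('o \<times> 'm) \<times> 'm \<times> ('o \<times> 'm)"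

definition is_alg_morphism :: "('o, 'm) cat \<Rightarrow> ('o, 'm) monad_data \<Rightarrow> ('o, 'm) alg_arr \<Rightarrow> bool" where
  "is_alg_morphism C T = (\<lambda>(A, f, B).
     is_algebra C T A \<and> is_algebra C T B \<and> f \<in> Hom C (fst A) (fst B) \<and>
     f \<cdot>\<^bsub>C\<^esub> snd A = snd B \<cdot>\<^bsub>C\<^esub> on_arr (endo T) f)"

definition alg_cat ::
    "('o, 'm) cat \<Rightarrow> ('o, 'm) monad_data \<Rightarrow> ('o \<times> 'm, ('o, 'm) alg_arr) cat" where
  "alg_cat C T =
     \<lparr>Obj = {A. is_algebra C T A},
      Arr = {F. is_alg_morphism C T F},
      Dom = (\<lambda>(A, f, B). A),
      Cod = (\<lambda>(A, f, B). B),
      Ident = (\<lambda>A. (A, Ident C (fst A), A)),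
      Comp = (\<lambda>(B', g, D) (A, f, B). (A, g \<cdot>\<^bsub>C\<^esub> f, D))\<rparr>"

definition forget :: "('o \<times> 'm, ('o, 'm) alg_arr, 'o, 'm) functor_data" where
  "forget = \<lparr>on_obj = (\<lambda>(c, \<gamma>). c), on_arr = (\<lambda>(A, f, B). f)\<rparr>"

definition pullback_alg :: "('o, 'm) cat \<Rightarrow> ('o \<Rightarrow> 'm) \<Rightarrow> 'o \<times> 'm \<Rightarrow> 'o \<times> 'm" where
  "pullback_alg C \<phi> = (\<lambda>(c, \<gamma>). (c, \<gamma> \<cdot>\<^bsub>C\<^esub> \<phi> c))"

definition phi_star ::
    "('o, 'm) cat \<Rightarrow> ('o \<Rightarrow> 'm) \<Rightarrow>
      ('o \<times> 'm, ('o, 'm) alg_arr, 'o \<times> 'm, ('o, 'm) alg_arr) functor_data" where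
  "phi_star C \<phi> =
     \<lparr>on_obj = pullback_alg C \<phi>,
      on_arr = (\<lambda>(A, f, B). (pullback_alg C \<phi> A, f, pullback_alg C \<phi> B))\<rparr>"

text \<open>The universal enveloping algebra functor is a chosen left adjoint of \<^term>\<open>phi_star\<close>; it is
  meaningful only if a left adjoint exists, and is then unique up to natural isomorphism.\<close>

definition phi_shriek ::
    "('o, 'm) cat \<Rightarrow> ('o, 'm) monad_data \<Rightarrow> ('o, 'm) monad_data \<Rightarrow> ('o \<Rightarrow> 'm) \<Rightarrow>
      ('o \<times> 'm, ('o, 'm) alg_arr, 'o \<times> 'm, ('o, 'm) alg_arr) functor_data" where
  "phi_shriek C M N \<phi> =
     (SOME F. left_adjoint (alg_cat C M) (alg_cat C N) F (phi_star C \<phi>))"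

definition PBW_property ::
    "('o, 'm) cat \<Rightarrow> ('o, 'm) monad_data \<Rightarrow> ('o, 'm) monad_data \<Rightarrow> ('o \<Rightarrow> 'm) \<Rightarrow> bool" where
  "PBW_property C M N \<phi> \<longleftrightarrow>
     (\<exists>X. is_endofunctor C X \<and>
        (\<exists>\<tau>. nat_iso (alg_cat C M) C (forget \<odot> phi_shriek C M N \<phi>) (X \<odot> forget) \<tau>))"


section \<open>Right modules over a monad\<close>

record ('o, 'm) module_data =
  carrier_functor :: "('o, 'm, 'o, 'm) functor_data"
  action :: "'o \<Rightarrow> 'm"

definition right_module ::
    "('o, 'm) cat \<Rightarrow> ('o, 'm) monad_data \<Rightarrow> ('o, 'm) module_data \<Rightarrow> bool" where
  "right_module C M R \<longleftrightarrow> is_endofunctor C (carrier_functor R) \<and>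
     nat_trans C C (carrier_functor R \<odot> endo M) (carrier_functor R) (action R) \<and>
     (\<forall>a\<in>Obj C.
        action R a \<cdot>\<^bsub>C\<^esub> action R (on_obj (endo M) a)
          = action R a \<cdot>\<^bsub>C\<^esub> on_arr (carrier_functor R) (mult M a) \<and>
        action R a \<cdot>\<^bsub>C\<^esub> on_arr (carrier_functor R) (eta M a)
          = Ident C (on_obj (carrier_functor R) a))"

definition module_hom ::
    "('o, 'm) cat \<Rightarrow> ('o, 'm) monad_data \<Rightarrow> ('o, 'm) module_data \<Rightarrow> ('o, 'm) module_data
      \<Rightarrow> ('o \<Rightarrow> 'm) \<Rightarrow> bool" where
  "module_hom C M R S \<sigma> \<longleftrightarrow>
     nat_trans C C (carrier_functor R) (carrier_functor S) \<sigma> \<and>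
     (\<forall>a\<in>Obj C. \<sigma> a \<cdot>\<^bsub>C\<^esub> action R a = action S a \<cdot>\<^bsub>C\<^esub> \<sigma> (on_obj (endo M) a))"

definition module_isomorphic ::
    "('o, 'm) cat \<Rightarrow> ('o, 'm) monad_data \<Rightarrow> ('o, 'm) module_data \<Rightarrow> ('o, 'm) module_data \<Rightarrow> bool" where
  "module_isomorphic C M R S \<longleftrightarrow>
     (\<exists>\<sigma> \<tau>. module_hom C M R S \<sigma> \<and> module_hom C M S R \<tau> \<and>
        (\<forall>a\<in>Obj C. \<tau> a \<cdot>\<^bsub>C\<^esub> \<sigma> a = Ident C (on_obj (carrier_functor R) a) \<and>
                   \<sigma> a \<cdot>\<^bsub>C\<^esub> \<tau> a = Ident C (on_obj (carrier_functor S) a)))"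

definition free_module ::
    "('o, 'm) monad_data \<Rightarrow> ('o, 'm, 'o, 'm) functor_data \<Rightarrow> ('o, 'm) module_data" where
  "free_module M X =
     \<lparr>carrier_functor = X \<odot> endo M, action = (\<lambda>a. on_arr X (mult M a))\<rparr>"

definition is_free_right_module ::
    "('o, 'm) cat \<Rightarrow> ('o, 'm) monad_data \<Rightarrow> ('o, 'm) module_data \<Rightarrow> bool" where
  "is_free_right_module C M R \<longleftrightarrow> right_module C M R \<and>
     (\<exists>X. is_endofunctor C X \<and> module_isomorphic C M R (free_module M X))"

definition module_via ::
    "('o, 'm) cat \<Rightarrow> ('o, 'm) monad_data \<Rightarrow> ('o \<Rightarrow> 'm) \<Rightarrow> ('o, 'm) module_data" where
  "module_via C N \<phi> =
     \<lparr>carrier_functor = endo N, action = (\<lambda>a. mult N a \<cdot>\<^bsub>C\<^esub> on_arr (endo N) (\<phi> a))\<rparr>"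

end

theory Submission
  imports Defs
begin

text \<open>
  Universal arrows identify the enveloping algebra \<open>\<phi>\<^sub>!(c)\<close> in two situations, and each
  situation gives one direction of the equivalence.

  For an arbitrary \<open>M\<close>-algebra \<open>(c, \<gamma>)\<close>, an arrow \<open>f : c \<rightarrow> d\<close> into an \<open>N\<close>-algebra is a
  morphism of \<open>M\<close>-algebras iff its extension \<open>N c \<rightarrow> d\<close> coequalizes \<open>N \<gamma>\<close> and the module action
  \<open>act c = \<mu>\<^sub>N \<cdot> N \<phi>\<close>, both from \<open>N M c\<close> to \<open>N c\<close>. So \<open>\<phi>\<^sub>!(c)\<close> is the coequalizer of this pair
  in the category of \<open>N\<close>-algebras (\<open>universal_arrow_coequalizer\<close>). The pair is reflexive, which
  gives the existence of \<open>\<phi>\<^sub>!\<close>. For a free algebra \<open>M c\<close> the coequalizer is known: it is the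
  free algebra \<open>N c\<close>, with universal arrow \<open>\<phi> c : M c \<rightarrow> N c\<close> (\<open>universal_arrow_free\<close>).

  Suppose that \<open>\<phi>\<^sub>!(c) \<cong> X c\<close> naturally in \<open>c\<close>. Restricting to free algebras gives
  \<open>N c \<cong> \<phi>\<^sub>!(M c) \<cong> X M c\<close>, naturally with respect to all morphisms of free \<open>M\<close>-algebras, and not
  only those of the form \<open>M f\<close>. The multiplication \<open>M M c \<rightarrow> M c\<close> is such a morphism, and it
  corresponds to \<open>act c\<close> because \<open>\<phi>\<close> is multiplicative. Naturality at the multiplication is
  precisely linearity of the isomorphism \<open>N \<cong> X M\<close> (\<open>free_if_PBW\<close>).

  Conversely, suppose \<open>N \<cong> X M\<close> as right modules. The pair above then becomes \<open>X\<close> applied to the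
  pair \<open>\<mu>, M \<gamma> : M M c \<rightarrow> M c\<close>, which is split in \<open>C\<close> with coequalizer \<open>\<gamma> : M c \<rightarrow> c\<close>.
  Splittings are preserved by \<open>X\<close>, and coequalizers of pairs that split in the base lift to
  algebras (\<open>coequalizer_of_split_pair\<close>). So \<open>X c\<close> carries an \<open>N\<close>-algebra structure that makes
  it the required coequalizer (\<open>PBW_if_free\<close>).

  In both directions \<open>left_adjoint_comparison\<close> transports the explicit description to the chosen
  left adjoint, together with its naturality.
\<close>

section \<open>Calculating with arrows\<close>

lemma in_HomD:
  assumes "f \<in> Hom C a b"
  shows "f \<in> Arr C" "Dom C f = a" "Cod C f = b"
  using assms by (auto simp: Hom_def)

lemma in_HomI: "f \<in> Arr C \<Longrightarrow> Dom C f = a \<Longrightarrow> Cod C f = b \<Longrightarrow> f \<in> Hom C a b"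
  by (simp add: Hom_def)

lemma Hom_objs:
  assumes "category C" "f \<in> Hom C a b"
  shows "a \<in> Obj C" "b \<in> Obj C"
  using assms by (auto simp: Hom_def category_def)

lemma Dom_Cod_in_Obj:
  assumes "category C" "f \<in> Arr C"
  shows "Dom C f \<in> Obj C" "Cod C f \<in> Obj C"
  using assms by (auto simp: category_def)

lemma comp_in_Hom:
  assumes "category C" "f \<in> Hom C a b" "g \<in> Hom C b c"
  shows "g \<cdot>\<^bsub>C\<^esub> f \<in> Hom C a c"
  using assms unfolding category_def by blast

lemma Ident_in_Hom: "category C \<Longrightarrow> a \<in> Obj C \<Longrightarrow> Ident C a \<in> Hom C a a"
  unfolding category_def by blast

lemma Ident_comp: "category C \<Longrightarrow> f \<in> Hom C a b \<Longrightarrow> Ident C b \<cdot>\<^bsub>C\<^esub> f = f"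
  unfolding category_def by blast

lemma comp_Ident: "category C \<Longrightarrow> f \<in> Hom C a b \<Longrightarrow> f \<cdot>\<^bsub>C\<^esub> Ident C a = f"
  unfolding category_def by blast

lemma comp_assoc:
  assumes "category C" "f \<in> Hom C a b" "g \<in> Hom C b c" "h \<in> Hom C c d"
  shows "(h \<cdot>\<^bsub>C\<^esub> g) \<cdot>\<^bsub>C\<^esub> f = h \<cdot>\<^bsub>C\<^esub> (g \<cdot>\<^bsub>C\<^esub> f)"
  using assms unfolding category_def by blast

text \<open>The same laws with typing expressed by \<^const>\<open>Dom\<close> and \<^const>\<open>Cod\<close>. In this form the
  simplifier can compute the type of every composite, so that equations between composites are
  decided by rewriting to right-nested normal form.\<close>

lemma comp_simps:
  assumes "category C" "f \<in> Arr C" "g \<in> Arr C" "Cod C f = Dom C g"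
  shows "g \<cdot>\<^bsub>C\<^esub> f \<in> Arr C" "Dom C (g \<cdot>\<^bsub>C\<^esub> f) = Dom C f" "Cod C (g \<cdot>\<^bsub>C\<^esub> f) = Cod C g"
  using comp_in_Hom[OF assms(1), of f "Dom C f" "Dom C g" g "Cod C g"] assms(2-4)
  by (auto simp: Hom_def)

lemma Ident_simps:
  assumes "category C" "a \<in> Obj C"
  shows "Ident C a \<in> Arr C" "Dom C (Ident C a) = a" "Cod C (Ident C a) = a"
  using Ident_in_Hom[OF assms] by (auto simp: Hom_def)

lemma comp_Ident_simps:
  assumes "category C" "f \<in> Arr C"
  shows "a = Cod C f \<Longrightarrow> Ident C a \<cdot>\<^bsub>C\<^esub> f = f" "a = Dom C f \<Longrightarrow> f \<cdot>\<^bsub>C\<^esub> Ident C a = f"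
  using Ident_comp[OF assms(1)] comp_Ident[OF assms(1)] assms(2) by (auto simp: Hom_def)

lemma comp_assoc_simp:
  assumes "category C" "f \<in> Arr C" "g \<in> Arr C" "h \<in> Arr C" "Cod C f = Dom C g" "Cod C g = Dom C h"
  shows "(h \<cdot>\<^bsub>C\<^esub> g) \<cdot>\<^bsub>C\<^esub> f = h \<cdot>\<^bsub>C\<^esub> (g \<cdot>\<^bsub>C\<^esub> f)"
  using comp_assoc[OF assms(1), of f "Dom C f" "Dom C g" g "Cod C g" h "Cod C h"] assms
  by (auto simp: Hom_def)

lemmas cat_simps = Dom_Cod_in_Obj comp_simps Ident_simps comp_Ident_simps comp_assoc_simp

text \<open>Normal forms are right-nested, so an equation between composites of two arrows applies inside
  a longer composite only after it has been extended by a further arrow on the right.\<close>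

lemma extend_square:
  assumes "g \<cdot>\<^bsub>C\<^esub> f = k \<cdot>\<^bsub>C\<^esub> h" "category C" "f \<in> Hom C a b" "g \<in> Hom C b d"
    "h \<in> Hom C a b'" "k \<in> Hom C b' d" "x \<in> Arr C" "Cod C x = a"
  shows "g \<cdot>\<^bsub>C\<^esub> f \<cdot>\<^bsub>C\<^esub> x = k \<cdot>\<^bsub>C\<^esub> h \<cdot>\<^bsub>C\<^esub> x"
proof -
  have "x \<in> Hom C (Dom C x) a" using assms by (simp add: Hom_def)
  then show ?thesis
    using comp_assoc[OF assms(2) _ assms(3,4)] comp_assoc[OF assms(2) _ assms(5,6)] assms(1) by simp
qed

lemma extend_triangle:
  assumes "g \<cdot>\<^bsub>C\<^esub> f = k" "category C" "f \<in> Hom C a b" "g \<in> Hom C b d" "x \<in> Arr C" "Cod C x = a"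
  shows "g \<cdot>\<^bsub>C\<^esub> f \<cdot>\<^bsub>C\<^esub> x = k \<cdot>\<^bsub>C\<^esub> x"
proof -
  have "x \<in> Hom C (Dom C x) a" using assms by (simp add: Hom_def)
  then show ?thesis using comp_assoc[OF assms(2) _ assms(3,4)] assms(1) by simp
qed

lemma functor_obj: "is_functor C D F \<Longrightarrow> a \<in> Obj C \<Longrightarrow> on_obj F a \<in> Obj D"
  by (simp add: is_functor_def)

lemma functor_Hom: "is_functor C D F \<Longrightarrow> f \<in> Hom C a b \<Longrightarrow> on_arr F f \<in> Hom D (on_obj F a) (on_obj F b)"
  by (simp add: is_functor_def)

lemma functor_Ident: "is_functor C D F \<Longrightarrow> a \<in> Obj C \<Longrightarrow> on_arr F (Ident C a) = Ident D (on_obj F a)"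
  by (simp add: is_functor_def)

lemma functor_comp:
  assumes "is_functor C D F" "f \<in> Hom C a b" "g \<in> Hom C b c"
  shows "on_arr F (g \<cdot>\<^bsub>C\<^esub> f) = on_arr F g \<cdot>\<^bsub>D\<^esub> on_arr F f"
  using assms unfolding is_functor_def by blast

lemma endofunctor_simps:
  assumes "is_endofunctor C F" "f \<in> Arr C"
  shows "on_arr F f \<in> Arr C" "Dom C (on_arr F f) = on_obj F (Dom C f)"
    "Cod C (on_arr F f) = on_obj F (Cod C f)"
  using functor_Hom[OF assms(1), of f "Dom C f" "Cod C f"] assms(2) by (auto simp: Hom_def)

lemma endofunctor_comp_simp:
  assumes "is_endofunctor C F" "f \<in> Arr C" "g \<in> Arr C" "Cod C f = Dom C g"
  shows "on_arr F (g \<cdot>\<^bsub>C\<^esub> f) = on_arr F g \<cdot>\<^bsub>C\<^esub> on_arr F f"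
  using functor_comp[OF assms(1), of f "Dom C f" "Dom C g" g "Cod C g"] assms
  by (auto simp: Hom_def)

lemma endofunctor_Ident_simp:
  "is_endofunctor C F \<Longrightarrow> a \<in> Obj C \<Longrightarrow> on_arr F (Ident C a) = Ident C (on_obj F a)"
  by (rule functor_Ident)

lemma endofunctor_obj_simp: "is_endofunctor C F \<Longrightarrow> a \<in> Obj C \<Longrightarrow> on_obj F a \<in> Obj C"
  by (rule functor_obj)

lemmas endo_simps = endofunctor_simps endofunctor_comp_simp endofunctor_Ident_simp
  endofunctor_obj_simp

lemma functor_preserves_iso:
  assumes C: "category C" and F: "is_functor C D F" and "is_iso C a b f"
  shows "is_iso D (on_obj F a) (on_obj F b) (on_arr F f)"
proof -
  obtain g where f: "f \<in> Hom C a b" and g: "g \<in> Hom C b a"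
    and gf: "g \<cdot>\<^bsub>C\<^esub> f = Ident C a" and fg: "f \<cdot>\<^bsub>C\<^esub> g = Ident C b"
    using assms(3) unfolding is_iso_def by blast
  have "on_arr F g \<cdot>\<^bsub>D\<^esub> on_arr F f = Ident D (on_obj F a)"
    "on_arr F f \<cdot>\<^bsub>D\<^esub> on_arr F g = Ident D (on_obj F b)"
    using functor_comp[OF F f g] functor_comp[OF F g f] gf fg
      functor_Ident[OF F Hom_objs(1)[OF C f]] functor_Ident[OF F Hom_objs(2)[OF C f]] by simp_all
  then show ?thesis
    unfolding is_iso_def using functor_Hom[OF F f] functor_Hom[OF F g] by blast
qed

lemma iso_comp:
  assumes C: "category C" and "is_iso C a b f" "is_iso C b c g"
  shows "is_iso C a c (g \<cdot>\<^bsub>C\<^esub> f)"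
proof -
  obtain f' where f: "f \<in> Hom C a b" "f' \<in> Hom C b a" "f' \<cdot>\<^bsub>C\<^esub> f = Ident C a" "f \<cdot>\<^bsub>C\<^esub> f' = Ident C b"
    using assms(2) unfolding is_iso_def by blast
  obtain g' where g: "g \<in> Hom C b c" "g' \<in> Hom C c b" "g' \<cdot>\<^bsub>C\<^esub> g = Ident C b" "g \<cdot>\<^bsub>C\<^esub> g' = Ident C c"
    using assms(3) unfolding is_iso_def by blast
  have [simp]: "x \<in> Arr C \<Longrightarrow> Cod C x = b \<Longrightarrow> g' \<cdot>\<^bsub>C\<^esub> g \<cdot>\<^bsub>C\<^esub> x = x" 
     "x \<in> Arr C \<Longrightarrow> Cod C x = b \<Longrightarrow> f \<cdot>\<^bsub>C\<^esub> f' \<cdot>\<^bsub>C\<^esub> x = x" for x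
    using extend_triangle[OF g(3) C g(1,2)] extend_triangle[OF f(4) C f(2,1)] C
    by (simp_all add: cat_simps)
  have "(f' \<cdot>\<^bsub>C\<^esub> g') \<cdot>\<^bsub>C\<^esub> g \<cdot>\<^bsub>C\<^esub> f = Ident C a" "(g \<cdot>\<^bsub>C\<^esub> f) \<cdot>\<^bsub>C\<^esub> f' \<cdot>\<^bsub>C\<^esub> g' = Ident C c"
    using f(3,4) g(3,4) C in_HomD[OF f(1)] in_HomD[OF f(2)] in_HomD[OF g(1)] in_HomD[OF g(2)]
    by (simp_all add: cat_simps)
  then show ?thesis
    unfolding is_iso_def using comp_in_Hom[OF C f(1) g(1)] comp_in_Hom[OF C g(2) f(2)] by blast
qed

lemma iso_inverse:
  assumes "is_iso C a b f"
  obtains g where "is_iso C b a g" "g \<cdot>\<^bsub>C\<^esub> f = Ident C a" "f \<cdot>\<^bsub>C\<^esub> g = Ident C b"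
  using assms unfolding is_iso_def by blast

text \<open>Inverses of natural isomorphisms are natural, and inverses of linear isomorphisms are linear;
  both are this statement about a single commutative square.\<close>

lemma inverse_square:
  assumes C: "category C" and s: "s \<in> Hom C a b" "s' \<in> Hom C b a" "s \<cdot>\<^bsub>C\<^esub> s' = Ident C b"
    and t: "t \<in> Hom C c d" "t' \<in> Hom C d c" "t' \<cdot>\<^bsub>C\<^esub> t = Ident C c"
    and f: "f \<in> Hom C a c" and g: "g \<in> Hom C b d" and eq: "t \<cdot>\<^bsub>C\<^esub> f = g \<cdot>\<^bsub>C\<^esub> s"
  shows "t' \<cdot>\<^bsub>C\<^esub> g = f \<cdot>\<^bsub>C\<^esub> s'"
proof -
  note types = C cat_simps in_HomD[OF s(1)] in_HomD[OF s(2)] in_HomD[OF t(1)] in_HomD[OF t(2)]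
    in_HomD[OF f] in_HomD[OF g]
  have "t' \<cdot>\<^bsub>C\<^esub> g = t' \<cdot>\<^bsub>C\<^esub> g \<cdot>\<^bsub>C\<^esub> s \<cdot>\<^bsub>C\<^esub> s'" unfolding s(3) by (simp add: types)
  also have "\<dots> = t' \<cdot>\<^bsub>C\<^esub> (g \<cdot>\<^bsub>C\<^esub> s) \<cdot>\<^bsub>C\<^esub> s'" by (simp add: types)
  also have "\<dots> = (t' \<cdot>\<^bsub>C\<^esub> t) \<cdot>\<^bsub>C\<^esub> f \<cdot>\<^bsub>C\<^esub> s'" unfolding eq[symmetric] by (simp add: types)
  also have "\<dots> = f \<cdot>\<^bsub>C\<^esub> s'" unfolding t(3) by (simp add: types)
  finally show ?thesis .
qed

lemma nat_trans_Hom: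
  "nat_trans C D F G \<tau> \<Longrightarrow> a \<in> Obj C \<Longrightarrow> \<tau> a \<in> Hom D (on_obj F a) (on_obj G a)"
  by (simp add: nat_trans_def)

lemma naturality:
  "nat_trans C D F G \<tau> \<Longrightarrow> f \<in> Hom C a b \<Longrightarrow> \<tau> b \<cdot>\<^bsub>D\<^esub> on_arr F f = on_arr G f \<cdot>\<^bsub>D\<^esub> \<tau> a"
  by (simp add: nat_trans_def)

lemma comp_functor_simps [simp]:
  "on_obj (G \<odot> F) a = on_obj G (on_obj F a)" "on_arr (G \<odot> F) f = on_arr G (on_arr F f)"
  by (simp_all add: comp_functor_def)

lemma id_functor_simps [simp]: "on_obj id_functor a = a" "on_arr id_functor f = f"
  by (simp_all add: id_functor_def)

lemma forget_simps [simp]: "on_obj forget A = fst A" "on_arr forget (A, f, B) = f"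
  by (simp_all add: forget_def case_prod_unfold)

section \<open>Universal arrows and left adjoints\<close>

definition universal_arrow ::
    "('o, 'm) cat \<Rightarrow> ('p, 'n) cat \<Rightarrow> ('p, 'n, 'o, 'm) functor_data \<Rightarrow> 'o \<Rightarrow> 'p \<Rightarrow> 'm \<Rightarrow> bool" where
  "universal_arrow C D G a b u \<longleftrightarrow> b \<in> Obj D \<and> u \<in> Hom C a (on_obj G b) \<and>
     (\<forall>d\<in>Obj D. \<forall>f\<in>Hom C a (on_obj G d). \<exists>!g. g \<in> Hom D b d \<and> on_arr G g \<cdot>\<^bsub>C\<^esub> u = f)"

lemma universal_arrow_ex:
  assumes "universal_arrow C D G a b u" "d \<in> Obj D" "f \<in> Hom C a (on_obj G d)"
  obtains g where "g \<in> Hom D b d" "on_arr G g \<cdot>\<^bsub>C\<^esub> u = f"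
  using assms unfolding universal_arrow_def by blast

lemma universal_arrow_eq:
  assumes "category C" "category D" "is_functor D C G" "universal_arrow C D G a b u"
    "g \<in> Hom D b d" "h \<in> Hom D b d" "on_arr G g \<cdot>\<^bsub>C\<^esub> u = on_arr G h \<cdot>\<^bsub>C\<^esub> u"
  shows "g = h"
proof -
  have u: "u \<in> Hom C a (on_obj G b)" using assms(4) by (simp add: universal_arrow_def)
  have "d \<in> Obj D" using assms(2,5) by (rule Hom_objs)
  moreover have "on_arr G g \<cdot>\<^bsub>C\<^esub> u \<in> Hom C a (on_obj G d)"
    using comp_in_Hom[OF assms(1) u functor_Hom[OF assms(3,5)]] .
  ultimately show ?thesis using assms(4-7) unfolding universal_arrow_def by metis
qed

text \<open>The functor \<open>F\<close> and the counit come from existence in the universal property. Functoriality,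
  naturality and the triangle identities are equations between arrows out of a universal object,
  and so need only be tested after composing with the universal arrow.\<close>

lemma left_adjoint_if_universal_arrows:
  assumes C: "category C" and D: "category D" and G: "is_functor D C G"
    and ex: "\<And>a. a \<in> Obj C \<Longrightarrow> \<exists>b u. universal_arrow C D G a b u"
  shows "\<exists>F. left_adjoint C D F G"
proof -
  obtain L u where univ: "\<And>a. a \<in> Obj C \<Longrightarrow> universal_arrow C D G a (L a) (u a)"
    using ex by metis
  have L: "L a \<in> Obj D" and u: "u a \<in> Hom C a (on_obj G (L a))" if "a \<in> Obj C" for a
    using univ[OF that] by (simp_all add: universal_arrow_def)
  have "\<exists>g. g \<in> Hom D (L (Dom C f)) (L (Cod C f)) \<and> on_arr G g \<cdot>\<^bsub>C\<^esub> u (Dom C f) = u (Cod C f) \<cdot>\<^bsub>C\<^esub> f"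
    if "f \<in> Arr C" for f
  proof -
    have obj: "Dom C f \<in> Obj C" "Cod C f \<in> Obj C" using C that by (simp_all add: cat_simps)
    have "u (Cod C f) \<cdot>\<^bsub>C\<^esub> f \<in> Hom C (Dom C f) (on_obj G (L (Cod C f)))"
      using comp_in_Hom[OF C _ u[OF obj(2)]] that by (simp add: Hom_def)
    then show ?thesis using universal_arrow_ex[OF univ[OF obj(1)] L[OF obj(2)]] by metis
  qed
  then obtain l where "\<And>f. f \<in> Arr C \<Longrightarrow> l f \<in> Hom D (L (Dom C f)) (L (Cod C f)) \<and>
      on_arr G (l f) \<cdot>\<^bsub>C\<^esub> u (Dom C f) = u (Cod C f) \<cdot>\<^bsub>C\<^esub> f"
    by metis
  then have l: "l f \<in> Hom D (L a) (L b)" and lu: "on_arr G (l f) \<cdot>\<^bsub>C\<^esub> u a = u b \<cdot>\<^bsub>C\<^esub> f"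
    if "f \<in> Hom C a b" for f a b
    using that by (auto simp: Hom_def)
  let ?F = "\<lparr>on_obj = L, on_arr = l\<rparr>"
  have F: "is_functor C D ?F"
    unfolding is_functor_def
  proof (intro conjI ballI allI; simp)
    fix a assume "a \<in> Obj C" then show "L a \<in> Obj D" by (rule L)
  next
    fix a b f assume "f \<in> Hom C a b" then show "l f \<in> Hom D (L a) (L b)" by (rule l)
  next
    fix a assume a: "a \<in> Obj C"
    note i = Ident_in_Hom[OF C a]
    show "l (Ident C a) = Ident D (L a)"
    proof (rule universal_arrow_eq[OF C D G univ[OF a] l[OF i] Ident_in_Hom[OF D L[OF a]]])
      show "on_arr G (l (Ident C a)) \<cdot>\<^bsub>C\<^esub> u a = on_arr G (Ident D (L a)) \<cdot>\<^bsub>C\<^esub> u a"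
        using lu[OF i] comp_Ident[OF C u[OF a]] Ident_comp[OF C u[OF a]] functor_Ident[OF G L[OF a]]
        by simp
    qed
  next
    fix a b c f g assume f: "f \<in> Hom C a b" and g: "g \<in> Hom C b c"
    note gf = comp_in_Hom[OF C f g]
    have a: "a \<in> Obj C" and b: "b \<in> Obj C" and c: "c \<in> Obj C"
      using Hom_objs[OF C f] Hom_objs[OF C g] by auto
    show "l (g \<cdot>\<^bsub>C\<^esub> f) = l g \<cdot>\<^bsub>D\<^esub> l f"
    proof (rule universal_arrow_eq[OF C D G univ[OF a] l[OF gf] comp_in_Hom[OF D l[OF f] l[OF g]]])
      have "on_arr G (l g \<cdot>\<^bsub>D\<^esub> l f) \<cdot>\<^bsub>C\<^esub> u a = on_arr G (l g) \<cdot>\<^bsub>C\<^esub> on_arr G (l f) \<cdot>\<^bsub>C\<^esub> u a"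
        using functor_comp[OF G l[OF f] l[OF g]]
          comp_assoc[OF C u[OF a] functor_Hom[OF G l[OF f]] functor_Hom[OF G l[OF g]]] by simp
      also have "\<dots> = (on_arr G (l g) \<cdot>\<^bsub>C\<^esub> u b) \<cdot>\<^bsub>C\<^esub> f"
        using lu[OF f] comp_assoc[OF C f u[OF b] functor_Hom[OF G l[OF g]]] by simp
      also have "\<dots> = u c \<cdot>\<^bsub>C\<^esub> g \<cdot>\<^bsub>C\<^esub> f"
        using lu[OF g] comp_assoc[OF C f g u[OF c]] by simp
      finally show "on_arr G (l (g \<cdot>\<^bsub>C\<^esub> f)) \<cdot>\<^bsub>C\<^esub> u a = on_arr G (l g \<cdot>\<^bsub>D\<^esub> l f) \<cdot>\<^bsub>C\<^esub> u a"
        using lu[OF gf] by simp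
    qed
  qed
  have unit: "nat_trans C C id_functor (G \<odot> ?F) u"
    using u lu by (simp add: nat_trans_def)
  have "\<exists>e. e \<in> Hom D (L (on_obj G d)) d \<and> on_arr G e \<cdot>\<^bsub>C\<^esub> u (on_obj G d) = Ident C (on_obj G d)"
    if d: "d \<in> Obj D" for d
    using universal_arrow_ex[OF univ[OF functor_obj[OF G d]] d Ident_in_Hom[OF C functor_obj[OF G d]]]
    by metis
  then obtain e where e: "\<And>d. d \<in> Obj D \<Longrightarrow> e d \<in> Hom D (L (on_obj G d)) d"
    and eu: "\<And>d. d \<in> Obj D \<Longrightarrow> on_arr G (e d) \<cdot>\<^bsub>C\<^esub> u (on_obj G d) = Ident C (on_obj G d)"
    by metis
  have counit: "nat_trans D D (?F \<odot> G) id_functor e"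
    unfolding nat_trans_def
  proof (intro conjI ballI allI; simp)
    fix d assume "d \<in> Obj D" then show "e d \<in> Hom D (L (on_obj G d)) d" by (rule e)
  next
    fix a b f assume f: "f \<in> Hom D a b"
    note a = Hom_objs(1)[OF D f] and b = Hom_objs(2)[OF D f]
    note Gf = functor_Hom[OF G f]
    note Ga = functor_obj[OF G a] and Gb = functor_obj[OF G b]
    show "e b \<cdot>\<^bsub>D\<^esub> l (on_arr G f) = f \<cdot>\<^bsub>D\<^esub> e a"
    proof (rule universal_arrow_eq[OF C D G univ[OF Ga] comp_in_Hom[OF D l[OF Gf] e[OF b]]
            comp_in_Hom[OF D e[OF a] f]])
      have "on_arr G (e b \<cdot>\<^bsub>D\<^esub> l (on_arr G f)) \<cdot>\<^bsub>C\<^esub> u (on_obj G a)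
          = on_arr G (e b) \<cdot>\<^bsub>C\<^esub> u (on_obj G b) \<cdot>\<^bsub>C\<^esub> on_arr G f"
        using functor_comp[OF G l[OF Gf] e[OF b]] lu[OF Gf]
          comp_assoc[OF C u[OF Ga] functor_Hom[OF G l[OF Gf]] functor_Hom[OF G e[OF b]]] by simp
      also have "\<dots> = on_arr G f"
        using comp_assoc[OF C Gf u[OF Gb] functor_Hom[OF G e[OF b]]] eu[OF b] Ident_comp[OF C Gf] by simp
      also have "\<dots> = on_arr G (f \<cdot>\<^bsub>D\<^esub> e a) \<cdot>\<^bsub>C\<^esub> u (on_obj G a)"
        using functor_comp[OF G e[OF a] f] eu[OF a] comp_Ident[OF C Gf]
          comp_assoc[OF C u[OF Ga] functor_Hom[OF G e[OF a]] Gf] by simp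
      finally show "on_arr G (e b \<cdot>\<^bsub>D\<^esub> l (on_arr G f)) \<cdot>\<^bsub>C\<^esub> u (on_obj G a)
          = on_arr G (f \<cdot>\<^bsub>D\<^esub> e a) \<cdot>\<^bsub>C\<^esub> u (on_obj G a)" .
    qed
  qed
  have triangle: "e (L a) \<cdot>\<^bsub>D\<^esub> l (u a) = Ident D (L a)" if a: "a \<in> Obj C" for a
  proof (rule universal_arrow_eq[OF C D G univ[OF a] comp_in_Hom[OF D l[OF u[OF a]] e[OF L[OF a]]]
            Ident_in_Hom[OF D L[OF a]]])
    note GL = functor_obj[OF G L[OF a]]
    have "on_arr G (e (L a) \<cdot>\<^bsub>D\<^esub> l (u a)) \<cdot>\<^bsub>C\<^esub> u a
        = on_arr G (e (L a)) \<cdot>\<^bsub>C\<^esub> u (on_obj G (L a)) \<cdot>\<^bsub>C\<^esub> u a"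
      using functor_comp[OF G l[OF u[OF a]] e[OF L[OF a]]] lu[OF u[OF a]]
        comp_assoc[OF C u[OF a] functor_Hom[OF G l[OF u[OF a]]] functor_Hom[OF G e[OF L[OF a]]]] by simp
    also have "\<dots> = u a"
      using comp_assoc[OF C u[OF a] u[OF GL] functor_Hom[OF G e[OF L[OF a]]]] eu[OF L[OF a]]
        Ident_comp[OF C u[OF a]] by simp
    finally show "on_arr G (e (L a) \<cdot>\<^bsub>D\<^esub> l (u a)) \<cdot>\<^bsub>C\<^esub> u a = on_arr G (Ident D (L a)) \<cdot>\<^bsub>C\<^esub> u a"
      using Ident_comp[OF C u[OF a]] functor_Ident[OF G L[OF a]] by simp
  qed
  show ?thesis
    unfolding left_adjoint_def using F G unit counit triangle eu
    by (intro exI[of _ ?F] conjI exI[of _ u] exI[of _ e]) simp_all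
qed

text \<open>The transpose of \<open>f\<close> is the counit after \<open>F f\<close>; uniqueness is naturality of the counit.\<close>

lemma left_adjoint_universal_unit:
  assumes C: "category C" and D: "category D" and adj: "left_adjoint C D F G"
  obtains \<eta> where "nat_trans C C id_functor (G \<odot> F) \<eta>"
    "\<And>a. a \<in> Obj C \<Longrightarrow> universal_arrow C D G a (on_obj F a) (\<eta> a)"
proof -
  have F: "is_functor C D F" and G: "is_functor D C G" using adj by (simp_all add: left_adjoint_def)
  obtain \<eta> \<epsilon> where \<eta>: "nat_trans C C id_functor (G \<odot> F) \<eta>" and \<epsilon>: "nat_trans D D (F \<odot> G) id_functor \<epsilon>"
    and t1: "\<And>a. a\<in>Obj C \<Longrightarrow> \<epsilon> (on_obj F a) \<cdot>\<^bsub>D\<^esub> on_arr F (\<eta> a) = Ident D (on_obj F a)"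
    and t2: "\<And>b. b\<in>Obj D \<Longrightarrow> on_arr G (\<epsilon> b) \<cdot>\<^bsub>C\<^esub> \<eta> (on_obj G b) = Ident C (on_obj G b)"
    using adj unfolding left_adjoint_def by blast
  have u: "\<eta> a \<in> Hom C a (on_obj G (on_obj F a))" if "a \<in> Obj C" for a
    using nat_trans_Hom[OF \<eta> that] by simp
  have e: "\<epsilon> d \<in> Hom D (on_obj F (on_obj G d)) d" if "d \<in> Obj D" for d
    using nat_trans_Hom[OF \<epsilon> that] by simp
  have "universal_arrow C D G a (on_obj F a) (\<eta> a)" if a: "a \<in> Obj C" for a
    unfolding universal_arrow_def
  proof (intro conjI ballI)
    fix d f assume d: "d \<in> Obj D" and f: "f \<in> Hom C a (on_obj G d)"
    show "\<exists>!g. g \<in> Hom D (on_obj F a) d \<and> on_arr G g \<cdot>\<^bsub>C\<^esub> \<eta> a = f"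
    proof (rule ex1I[of _ "\<epsilon> d \<cdot>\<^bsub>D\<^esub> on_arr F f"]; (elim conjE)?)
      note Ff = functor_Hom[OF F f]
      have "on_arr G (\<epsilon> d \<cdot>\<^bsub>D\<^esub> on_arr F f) \<cdot>\<^bsub>C\<^esub> \<eta> a = on_arr G (\<epsilon> d) \<cdot>\<^bsub>C\<^esub> on_arr G (on_arr F f) \<cdot>\<^bsub>C\<^esub> \<eta> a"
        using functor_comp[OF G Ff e[OF d]]
          comp_assoc[OF C u[OF a] functor_Hom[OF G Ff] functor_Hom[OF G e[OF d]]] by simp
      also have "on_arr G (on_arr F f) \<cdot>\<^bsub>C\<^esub> \<eta> a = \<eta> (on_obj G d) \<cdot>\<^bsub>C\<^esub> f"
        using naturality[OF \<eta> f] by simp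
      also have "on_arr G (\<epsilon> d) \<cdot>\<^bsub>C\<^esub> \<eta> (on_obj G d) \<cdot>\<^bsub>C\<^esub> f = f"
        using comp_assoc[OF C f u[OF functor_obj[OF G d]] functor_Hom[OF G e[OF d]]] t2[OF d]
          Ident_comp[OF C f] by simp
      finally show "\<epsilon> d \<cdot>\<^bsub>D\<^esub> on_arr F f \<in> Hom D (on_obj F a) d \<and> on_arr G (\<epsilon> d \<cdot>\<^bsub>D\<^esub> on_arr F f) \<cdot>\<^bsub>C\<^esub> \<eta> a = f"
        using comp_in_Hom[OF D Ff e[OF d]] by simp
    next
      fix g assume g: "g \<in> Hom D (on_obj F a) d" and gf: "on_arr G g \<cdot>\<^bsub>C\<^esub> \<eta> a = f"
      note Gg = functor_Hom[OF G g]
      have "\<epsilon> d \<cdot>\<^bsub>D\<^esub> on_arr F f = \<epsilon> d \<cdot>\<^bsub>D\<^esub> on_arr F (on_arr G g) \<cdot>\<^bsub>D\<^esub> on_arr F (\<eta> a)"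
        using gf functor_comp[OF F u[OF a] Gg] by simp
      also have "\<dots> = (\<epsilon> d \<cdot>\<^bsub>D\<^esub> on_arr F (on_arr G g)) \<cdot>\<^bsub>D\<^esub> on_arr F (\<eta> a)"
        using comp_assoc[OF D functor_Hom[OF F u[OF a]] functor_Hom[OF F Gg] e[OF d]] by simp
      also have "\<dots> = g"
        using naturality[OF \<epsilon> g] t1[OF a] comp_Ident[OF D g]
          comp_assoc[OF D functor_Hom[OF F u[OF a]] e[OF functor_obj[OF F a]] g] by simp
      finally show "g = \<epsilon> d \<cdot>\<^bsub>D\<^esub> on_arr F f" ..
    qed
  qed (use a functor_obj[OF F a] u[OF a] in auto)
  then show thesis using that \<eta> by blast
qed

text \<open>Any arrow \<open>l\<close> that lies over \<open>h\<close> along the universal arrows is forced by uniqueness to correspond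
  to \<open>F h\<close>, so naturality follows although \<open>L\<close> is only a family of objects. The family is
  indexed, instead of being a function of the object \<open>A i\<close>, because for free algebras the
  universal arrow depends on the generating object, which the algebra need not determine.\<close>

lemma left_adjoint_comparison:
  assumes C: "category C" and D: "category D" and adj: "left_adjoint C D F G"
    and obj: "\<And>i. i \<in> I \<Longrightarrow> A i \<in> Obj C"
    and univ: "\<And>i. i \<in> I \<Longrightarrow> universal_arrow C D G (A i) (L i) (u i)"
  shows "\<exists>k. (\<forall>i\<in>I. is_iso D (on_obj F (A i)) (L i) (k i)) \<and>
    (\<forall>i\<in>I. \<forall>j\<in>I. \<forall>h\<in>Hom C (A i) (A j). \<forall>l\<in>Hom D (L i) (L j).
       on_arr G l \<cdot>\<^bsub>C\<^esub> u i = u j \<cdot>\<^bsub>C\<^esub> h \<longrightarrow> k j \<cdot>\<^bsub>D\<^esub> on_arr F h = l \<cdot>\<^bsub>D\<^esub> k i)"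
proof -
  have F: "is_functor C D F" and G: "is_functor D C G" using adj by (simp_all add: left_adjoint_def)
  obtain \<eta> where \<eta>: "nat_trans C C id_functor (G \<odot> F) \<eta>"
    and \<eta>u: "\<And>a. a \<in> Obj C \<Longrightarrow> universal_arrow C D G a (on_obj F a) (\<eta> a)"
    using left_adjoint_universal_unit[OF C D adj] by blast
  have \<eta>h: "\<eta> a \<in> Hom C a (on_obj G (on_obj F a))" if "a \<in> Obj C" for a
    using nat_trans_Hom[OF \<eta> that] by simp
  have L: "L i \<in> Obj D" and u: "u i \<in> Hom C (A i) (on_obj G (L i))" if "i \<in> I" for i
    using univ[OF that] by (simp_all add: universal_arrow_def)
  have "\<exists>g. g \<in> Hom D (on_obj F (A i)) (L i) \<and> on_arr G g \<cdot>\<^bsub>C\<^esub> \<eta> (A i) = u i" if "i \<in> I" for i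
    using universal_arrow_ex[OF \<eta>u[OF obj[OF that]] L[OF that] u[OF that]] by metis
  then obtain k where k: "\<And>i. i \<in> I \<Longrightarrow> k i \<in> Hom D (on_obj F (A i)) (L i)"
    and ku: "\<And>i. i \<in> I \<Longrightarrow> on_arr G (k i) \<cdot>\<^bsub>C\<^esub> \<eta> (A i) = u i"
    by metis
  show ?thesis
  proof (intro exI[of _ k] conjI ballI impI)
    fix i assume i: "i \<in> I"
    note Fa = functor_obj[OF F obj[OF i]]
    obtain v where v: "v \<in> Hom D (L i) (on_obj F (A i))" and vu: "on_arr G v \<cdot>\<^bsub>C\<^esub> u i = \<eta> (A i)"
      using universal_arrow_ex[OF univ[OF i] Fa \<eta>h[OF obj[OF i]]] .
    have "v \<cdot>\<^bsub>D\<^esub> k i = Ident D (on_obj F (A i))"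
    proof (rule universal_arrow_eq[OF C D G \<eta>u[OF obj[OF i]] comp_in_Hom[OF D k[OF i] v] Ident_in_Hom[OF D Fa]])
      show "on_arr G (v \<cdot>\<^bsub>D\<^esub> k i) \<cdot>\<^bsub>C\<^esub> \<eta> (A i) = on_arr G (Ident D (on_obj F (A i))) \<cdot>\<^bsub>C\<^esub> \<eta> (A i)"
        using functor_comp[OF G k[OF i] v] functor_Ident[OF G Fa] Ident_comp[OF C \<eta>h[OF obj[OF i]]]
          comp_assoc[OF C \<eta>h[OF obj[OF i]] functor_Hom[OF G k[OF i]] functor_Hom[OF G v]] ku[OF i] vu
        by simp
    qed
    moreover have "k i \<cdot>\<^bsub>D\<^esub> v = Ident D (L i)"
    proof (rule universal_arrow_eq[OF C D G univ[OF i] comp_in_Hom[OF D v k[OF i]] Ident_in_Hom[OF D L[OF i]]])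
      show "on_arr G (k i \<cdot>\<^bsub>D\<^esub> v) \<cdot>\<^bsub>C\<^esub> u i = on_arr G (Ident D (L i)) \<cdot>\<^bsub>C\<^esub> u i"
        using functor_comp[OF G v k[OF i]] functor_Ident[OF G L[OF i]] Ident_comp[OF C u[OF i]]
          comp_assoc[OF C u[OF i] functor_Hom[OF G v] functor_Hom[OF G k[OF i]]] ku[OF i] vu
        by simp
    qed
    ultimately show "is_iso D (on_obj F (A i)) (L i) (k i)"
      unfolding is_iso_def using k[OF i] v by blast
  next
    fix i j h l
    assume i: "i \<in> I" and j: "j \<in> I" and h: "h \<in> Hom C (A i) (A j)" and l: "l \<in> Hom D (L i) (L j)"
      and lu: "on_arr G l \<cdot>\<^bsub>C\<^esub> u i = u j \<cdot>\<^bsub>C\<^esub> h"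
    note Fh = functor_Hom[OF F h]
    show "k j \<cdot>\<^bsub>D\<^esub> on_arr F h = l \<cdot>\<^bsub>D\<^esub> k i"
    proof (rule universal_arrow_eq[OF C D G \<eta>u[OF obj[OF i]] comp_in_Hom[OF D Fh k[OF j]] comp_in_Hom[OF D k[OF i] l]])
      have "on_arr G (k j \<cdot>\<^bsub>D\<^esub> on_arr F h) \<cdot>\<^bsub>C\<^esub> \<eta> (A i) = on_arr G (k j) \<cdot>\<^bsub>C\<^esub> \<eta> (A j) \<cdot>\<^bsub>C\<^esub> h"
        using functor_comp[OF G Fh k[OF j]] naturality[OF \<eta> h]
          comp_assoc[OF C \<eta>h[OF obj[OF i]] functor_Hom[OF G Fh] functor_Hom[OF G k[OF j]]] by simp
      also have "\<dots> = u j \<cdot>\<^bsub>C\<^esub> h"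
        using comp_assoc[OF C h \<eta>h[OF obj[OF j]] functor_Hom[OF G k[OF j]]] ku[OF j] by simp
      also have "\<dots> = on_arr G (l \<cdot>\<^bsub>D\<^esub> k i) \<cdot>\<^bsub>C\<^esub> \<eta> (A i)"
        using functor_comp[OF G k[OF i] l] lu ku[OF i]
          comp_assoc[OF C \<eta>h[OF obj[OF i]] functor_Hom[OF G k[OF i]] functor_Hom[OF G l]] by simp
      finally show "on_arr G (k j \<cdot>\<^bsub>D\<^esub> on_arr F h) \<cdot>\<^bsub>C\<^esub> \<eta> (A i) = on_arr G (l \<cdot>\<^bsub>D\<^esub> k i) \<cdot>\<^bsub>C\<^esub> \<eta> (A i)" .
    qed
  qed
qed

section \<open>Algebras over one monad\<close>

locale monad_on =
  fixes C :: "('o, 'm) cat" (structure) and T :: "('o, 'm) monad_data"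
  assumes cat: "category C" and monad: "monad C T"
begin

abbreviation To :: "'o \<Rightarrow> 'o" where "To \<equiv> on_obj (endo T)"
abbreviation Ta :: "'m \<Rightarrow> 'm" where "Ta \<equiv> on_arr (endo T)"
abbreviation free :: "'o \<Rightarrow> 'o \<times> 'm" where "free c \<equiv> (To c, mult T c)"

lemma endo: "is_endofunctor C (endo T)"
  using monad by (simp add: monad_def)

lemma mult_nat: "nat_trans C C (endo T \<odot> endo T) (endo T) (mult T)"
  and eta_nat: "nat_trans C C id_functor (endo T) (eta T)"
  using monad by (simp_all add: monad_def)

lemma mult_in_Hom: "a \<in> Obj C \<Longrightarrow> mult T a \<in> Hom C (To (To a)) (To a)"
  using nat_trans_Hom[OF mult_nat] by simp

lemma eta_in_Hom: "a \<in> Obj C \<Longrightarrow> eta T a \<in> Hom C a (To a)"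
  using nat_trans_Hom[OF eta_nat] by simp

lemmas monad_simps = cat cat_simps endo endo_simps in_HomD[OF mult_in_Hom] in_HomD[OF eta_in_Hom]

lemma mult_natural: "f \<in> Hom C a b \<Longrightarrow> mult T b \<cdot> Ta (Ta f) = Ta f \<cdot> mult T a"
  using naturality[OF mult_nat, of f a b] by simp

lemma eta_natural: "f \<in> Hom C a b \<Longrightarrow> eta T b \<cdot> f = Ta f \<cdot> eta T a"
  using naturality[OF eta_nat, of f a b] by simp

lemma mult_mult: "a \<in> Obj C \<Longrightarrow> mult T a \<cdot> mult T (To a) = mult T a \<cdot> Ta (mult T a)"
  and mult_eta: "a \<in> Obj C \<Longrightarrow> mult T a \<cdot> eta T (To a) = Ident C (To a)"
  and mult_Ta_eta: "a \<in> Obj C \<Longrightarrow> mult T a \<cdot> Ta (eta T a) = Ident C (To a)"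
  using monad by (simp_all add: monad_def)

lemma algD:
  assumes "is_algebra C T (c, \<gamma>)"
  shows "c \<in> Obj C" "\<gamma> \<in> Hom C (To c) c" "\<gamma> \<in> Arr C" "Dom C \<gamma> = To c" "Cod C \<gamma> = c"
    "\<gamma> \<cdot> mult T c = \<gamma> \<cdot> Ta \<gamma>" "\<gamma> \<cdot> eta T c = Ident C c"
  using assms by (auto simp: is_algebra_def Hom_def)

lemma alg_morphismD:
  assumes "is_alg_morphism C T ((c, \<gamma>), f, (d, \<delta>))"
  shows "is_algebra C T (c, \<gamma>)" "is_algebra C T (d, \<delta>)" "f \<in> Hom C c d" "f \<in> Arr C" "Dom C f = c"
    "Cod C f = d" "f \<cdot> \<gamma> = \<delta> \<cdot> Ta f"
  using assms by (auto simp: is_alg_morphism_def Hom_def)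

lemma free_algebra: "c \<in> Obj C \<Longrightarrow> is_algebra C T (free c)"
  using mult_mult mult_eta endo mult_in_Hom by (simp add: is_algebra_def endo_simps)

lemma alg_cat_simps [simp]:
  "A \<in> Obj (alg_cat C T) \<longleftrightarrow> is_algebra C T A"
  "Ident (alg_cat C T) A = (A, Ident C (fst A), A)"
  "(B', g, D) \<cdot>\<^bsub>alg_cat C T\<^esub> (A, f, B) = (A, g \<cdot> f, D)"
  by (simp_all add: alg_cat_def)

lemma Hom_alg_cat: "F \<in> Hom (alg_cat C T) A B \<longleftrightarrow> (\<exists>f. F = (A, f, B) \<and> is_alg_morphism C T (A, f, B))"
  by (cases F) (auto simp: Hom_def alg_cat_def)

lemma Hom_alg_cat_iff [simp]:
  "(A, f, B) \<in> Hom (alg_cat C T) A' B' \<longleftrightarrow> A' = A \<and> B' = B \<and> is_alg_morphism C T (A, f, B)"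
  by (auto simp: Hom_alg_cat)

lemma alg_morphism_Ident:
  assumes "is_algebra C T A"
  shows "is_alg_morphism C T (A, Ident C (fst A), A)"
proof (cases A)
  case (Pair c \<gamma>)
  then show ?thesis
    using assms algD[of c \<gamma>] Ident_in_Hom[OF cat, of c]
    by (simp add: is_alg_morphism_def monad_simps)
qed

lemma alg_morphism_comp:
  assumes "is_alg_morphism C T (A, f, B)" "is_alg_morphism C T (B, g, D)"
  shows "is_alg_morphism C T (A, g \<cdot> f, D)"
proof -
  obtain a \<alpha> where A: "A = (a, \<alpha>)" by fastforce
  obtain b \<beta> where B: "B = (b, \<beta>)" by fastforce
  obtain d \<delta> where D: "D = (d, \<delta>)" by fastforce
  note f = alg_morphismD[OF assms(1)[unfolded A B]] and g = alg_morphismD[OF assms(2)[unfolded B D]]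
  note a = algD[OF f(1)] and b = algD[OF f(2)] and d = algD[OF g(2)]
  have "(g \<cdot> f) \<cdot> \<alpha> = g \<cdot> \<beta> \<cdot> Ta f"
    using f g a b d by (simp add: monad_simps)
  also have "\<dots> = \<delta> \<cdot> Ta g \<cdot> Ta f"
    using extend_square[OF g(7) cat b(2) g(3) functor_Hom[OF endo g(3)] d(2)] f
    by (simp add: monad_simps)
  finally show ?thesis
    using f g a b d comp_in_Hom[OF cat f(3) g(3)]
    by (simp add: is_alg_morphism_def monad_simps A B D)
qed

lemma category_alg_cat: "category (alg_cat C T)"
  unfolding category_def
proof (intro conjI allI ballI; (clarsimp simp: Hom_alg_cat)?)
  fix F assume "F \<in> Arr (alg_cat C T)"
  then show "is_algebra C T (Dom (alg_cat C T) F)" "is_algebra C T (Cod (alg_cat C T) F)"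
    by (auto simp: alg_cat_def is_alg_morphism_def)
next
  fix c \<gamma> assume "is_algebra C T (c, \<gamma>)"
  then show "is_alg_morphism C T ((c, \<gamma>), Ident C c, c, \<gamma>)" using alg_morphism_Ident by fastforce
next
  fix a \<alpha> b \<beta> d \<delta> f g
  assume "is_alg_morphism C T ((a, \<alpha>), f, b, \<beta>)" "is_alg_morphism C T ((b, \<beta>), g, d, \<delta>)"
  then show "is_alg_morphism C T ((a, \<alpha>), g \<cdot> f, d, \<delta>)" by (rule alg_morphism_comp)
next
  fix a \<alpha> b \<beta> f
  assume f: "is_alg_morphism C T ((a, \<alpha>), f, b, \<beta>)"
  show "Ident C b \<cdot> f = f" "f \<cdot> Ident C a = f"
    using alg_morphismD[OF f] by (simp_all add: monad_simps)
next
  fix a \<alpha> b \<beta> c \<gamma> d \<delta> f g h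
  assume "is_alg_morphism C T ((a, \<alpha>), f, b, \<beta>)" "is_alg_morphism C T ((b, \<beta>), g, c, \<gamma>)"
    "is_alg_morphism C T ((c, \<gamma>), h, d, \<delta>)"
  then show "(h \<cdot> g) \<cdot> f = h \<cdot> g \<cdot> f"
    using comp_assoc[OF cat] by (metis alg_morphismD(3))
qed

lemma forget_functor: "is_functor (alg_cat C T) C forget"
  unfolding is_functor_def
  by (auto simp: Hom_alg_cat forget_def is_alg_morphism_def is_algebra_def)

text \<open>The free algebra on \<open>c\<close> represents \<open>d \<mapsto> Hom C c d\<close>: arrows \<open>c \<rightarrow> d\<close> extend to \<open>free c\<close>, and a
  morphism out of \<open>free c\<close> is the extension of its restriction along the unit.\<close>

lemma free_extension:
  assumes d: "is_algebra C T (d, \<delta>)" and f: "f \<in> Hom C c d"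
  shows "is_alg_morphism C T (free c, \<delta> \<cdot> Ta f, (d, \<delta>))" "(\<delta> \<cdot> Ta f) \<cdot> eta T c = f"
proof -
  note c = Hom_objs(1)[OF cat f]
  note d' = algD[OF d] and f' = in_HomD[OF f]
  note Tf = functor_Hom[OF endo f]
  have "\<delta> \<cdot> Ta f \<cdot> mult T c = \<delta> \<cdot> mult T d \<cdot> Ta (Ta f)"
    using mult_natural[OF f] by simp
  also have "\<dots> = \<delta> \<cdot> Ta \<delta> \<cdot> Ta (Ta f)"
    using extend_square[OF d'(6) cat mult_in_Hom d'(2) functor_Hom[OF endo d'(2)] d'(2)] d' f' by (simp add: monad_simps)
  finally show "is_alg_morphism C T (free c, \<delta> \<cdot> Ta f, (d, \<delta>))"
    using free_algebra[OF c] d d' f' c comp_in_Hom[OF cat Tf d'(2)]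
    by (simp add: is_alg_morphism_def monad_simps)
  have "(\<delta> \<cdot> Ta f) \<cdot> eta T c = \<delta> \<cdot> eta T d \<cdot> f"
    using eta_natural[OF f] c d' f' by (simp add: monad_simps)
  also have "\<dots> = f"
    using extend_triangle[OF d'(7) cat eta_in_Hom d'(2)] d' f' by (simp add: monad_simps)
  finally show "(\<delta> \<cdot> Ta f) \<cdot> eta T c = f" .
qed

lemma morphism_from_free:
  assumes c: "c \<in> Obj C" and g: "is_alg_morphism C T (free c, g, (d, \<delta>))"
  shows "\<delta> \<cdot> Ta (g \<cdot> eta T c) = g"
proof -
  note g' = alg_morphismD[OF g]
  note d = algD[OF g'(2)]
  have "\<delta> \<cdot> Ta (g \<cdot> eta T c) = (\<delta> \<cdot> Ta g) \<cdot> Ta (eta T c)"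
    using c d g' by (simp add: monad_simps del: g'(7))
  also have "\<dots> = g \<cdot> mult T c \<cdot> Ta (eta T c)"
    using g'(7)[symmetric] c d(1-5) g'(3-6) by (simp add: monad_simps)
  also have "\<dots> = g"
    using mult_Ta_eta[OF c] c g'(3-6) by (simp add: monad_simps)
  finally show ?thesis .
qed

lemma free_morphism_eqI:
  assumes "c \<in> Obj C" "is_alg_morphism C T (free c, g, (d, \<delta>))"
    "is_alg_morphism C T (free c, h, (d, \<delta>))" and eq: "g \<cdot> eta T c = h \<cdot> eta T c"
  shows "g = h"
proof -
  have "g = \<delta> \<cdot> Ta (g \<cdot> eta T c)" by (rule morphism_from_free[OF assms(1,2), symmetric])
  also have "\<dots> = h" unfolding eq by (rule morphism_from_free[OF assms(1,3)])
  finally show ?thesis .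
qed

lemma Ta_alg_morphism:
  assumes "f \<in> Hom C a b"
  shows "is_alg_morphism C T (free a, Ta f, free b)"
  using free_algebra[OF Hom_objs(1)[OF cat assms]] free_algebra[OF Hom_objs(2)[OF cat assms]]
    functor_Hom[OF endo assms] mult_natural[OF assms]
  by (simp add: is_alg_morphism_def)

text \<open>The forgetful functor creates coequalizers of pairs that are split in the base category: the
  action \<open>\<epsilon> = q \<cdot> \<beta> \<cdot> Ta s\<close> is forced because \<open>s\<close> is a section of the prospective
  morphism \<open>q\<close>, and the splitting identities, being preserved by every functor, make it work.\<close>

lemma coequalizer_of_split_pair:
  assumes f: "is_alg_morphism C T ((a, \<alpha>), f, (b, \<beta>))"
    and g: "is_alg_morphism C T ((a, \<alpha>), g, (b, \<beta>))"
    and q: "q \<in> Hom C b e" and s: "s \<in> Hom C e b" and t: "t \<in> Hom C b a"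
    and qf: "q \<cdot> f = q \<cdot> g" and qs: "q \<cdot> s = Ident C e"
    and ft: "f \<cdot> t = Ident C b" and gt: "g \<cdot> t = s \<cdot> q"
  shows "is_coequalizer (alg_cat C T) (a, \<alpha>) (b, \<beta>) ((a, \<alpha>), f, (b, \<beta>)) ((a, \<alpha>), g, (b, \<beta>))
    (e, q \<cdot> \<beta> \<cdot> Ta s) ((b, \<beta>), q, (e, q \<cdot> \<beta> \<cdot> Ta s))"
proof -
  define \<epsilon> where "\<epsilon> = q \<cdot> \<beta> \<cdot> Ta s"
  note f' = alg_morphismD[OF f] and g' = alg_morphismD[OF g]
  note a = algD[OF f'(1)] and b = algD[OF f'(2)]
  note q' = in_HomD[OF q] and s' = in_HomD[OF s] and t' = in_HomD[OF t]
  note e = Hom_objs(1)[OF cat s]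
  note types = monad_simps a(1,3-5) b(1,3-5) f'(4-6) g'(4-6) q' s' t' e
  note qf_ext = extend_square[OF qf cat f'(3) q g'(3) q]
  have \<epsilon>: "\<epsilon> \<in> Hom C (To e) e"
    unfolding \<epsilon>_def by (rule in_HomI) (simp_all add: types)
  \<comment> \<open>\<open>Ta (s \<cdot> q) = Ta (g \<cdot> t)\<close> lets the action pass through \<open>g\<close>; then \<open>q\<close> exchanges \<open>g\<close> for \<open>f\<close>, of
    which \<open>t\<close> is a section.\<close>
  have q_mor: "q \<cdot> \<beta> = \<epsilon> \<cdot> Ta q"
  proof -
    have "\<epsilon> \<cdot> Ta q = q \<cdot> \<beta> \<cdot> Ta (s \<cdot> q)" unfolding \<epsilon>_def by (simp add: types)
    also have "\<dots> = q \<cdot> \<beta> \<cdot> Ta g \<cdot> Ta t" unfolding gt[symmetric] by (simp add: types)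
    also have "\<beta> \<cdot> Ta g \<cdot> Ta t = g \<cdot> \<alpha> \<cdot> Ta t"
      using extend_square[OF g'(7) cat a(2) g'(3) functor_Hom[OF endo g'(3)] b(2), of "Ta t"]
      by (simp add: types)
    also have "q \<cdot> g \<cdot> \<alpha> \<cdot> Ta t = q \<cdot> f \<cdot> \<alpha> \<cdot> Ta t"
      using qf_ext by (simp add: types)
    also have "f \<cdot> \<alpha> \<cdot> Ta t = \<beta> \<cdot> Ta f \<cdot> Ta t"
      using extend_square[OF f'(7) cat a(2) f'(3) functor_Hom[OF endo f'(3)] b(2), of "Ta t"]
      by (simp add: types)
    also have "Ta f \<cdot> Ta t = Ta (f \<cdot> t)" by (simp add: types)
    finally show ?thesis unfolding ft by (simp add: types)
  qed
  have alg: "is_algebra C T (e, \<epsilon>)"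
  proof -
    have "\<epsilon> \<cdot> Ta \<epsilon> = (\<epsilon> \<cdot> Ta q) \<cdot> Ta \<beta> \<cdot> Ta (Ta s)"
      using in_HomD[OF \<epsilon>] by (simp add: \<epsilon>_def types)
    also have "\<dots> = q \<cdot> (\<beta> \<cdot> Ta \<beta>) \<cdot> Ta (Ta s)"
      unfolding q_mor[symmetric] by (simp add: types)
    also have "\<dots> = q \<cdot> \<beta> \<cdot> mult T b \<cdot> Ta (Ta s)"
      unfolding b(6)[symmetric] by (simp add: types)
    also have "\<dots> = \<epsilon> \<cdot> mult T e"
      unfolding mult_natural[OF s] \<epsilon>_def by (simp add: types)
    finally have "\<epsilon> \<cdot> mult T e = \<epsilon> \<cdot> Ta \<epsilon>" ..
    moreover have "\<epsilon> \<cdot> eta T e = Ident C e"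
    proof -
      have "\<epsilon> \<cdot> eta T e = q \<cdot> \<beta> \<cdot> eta T b \<cdot> s"
        unfolding eta_natural[OF s] \<epsilon>_def by (simp add: types)
      also have "\<dots> = q \<cdot> s"
        using extend_triangle[OF b(7) cat eta_in_Hom b(2), of s] by (simp add: types)
      finally show ?thesis unfolding qs .
    qed
    ultimately show ?thesis using e \<epsilon> by (simp add: is_algebra_def)
  qed
  have q_alg: "is_alg_morphism C T ((b, \<beta>), q, (e, \<epsilon>))"
    using alg f'(2) q q_mor by (simp add: is_alg_morphism_def)
  have desc: "is_alg_morphism C T ((e, \<epsilon>), h \<cdot> s, (z, \<zeta>))" "(h \<cdot> s) \<cdot> q = h"
    if h: "is_alg_morphism C T ((b, \<beta>), h, (z, \<zeta>))" and hf: "h \<cdot> f = h \<cdot> g" for h z \<zeta>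
  proof -
    note h' = alg_morphismD[OF h]
    note z = algD[OF h'(2)]
    have "(h \<cdot> s) \<cdot> q = h \<cdot> g \<cdot> t" unfolding gt using h'(3-6) by (simp add: types)
    also have "\<dots> = h \<cdot> f \<cdot> t"
      using extend_square[OF hf cat f'(3) h'(3) g'(3) h'(3), of t] by (simp add: types)
    also have "\<dots> = h" unfolding ft using h'(3-6) by (simp add: types)
    finally show hsq: "(h \<cdot> s) \<cdot> q = h" .
    have "(h \<cdot> s) \<cdot> \<epsilon> = ((h \<cdot> s) \<cdot> q) \<cdot> \<beta> \<cdot> Ta s" unfolding \<epsilon>_def using h'(3-6) by (simp add: types)
    also have "\<dots> = h \<cdot> \<beta> \<cdot> Ta s" unfolding hsq ..
    also have "\<dots> = \<zeta> \<cdot> Ta h \<cdot> Ta s"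
      using extend_square[OF h'(7) cat b(2) h'(3) functor_Hom[OF endo h'(3)] z(2), of "Ta s"]
      by (simp add: types)
    also have "\<dots> = \<zeta> \<cdot> Ta (h \<cdot> s)" using h'(3-6) by (simp add: types)
    finally show "is_alg_morphism C T ((e, \<epsilon>), h \<cdot> s, (z, \<zeta>))"
      using alg h'(2) comp_in_Hom[OF cat s h'(3)] by (simp add: is_alg_morphism_def)
  qed
  have uniq: "k = h \<cdot> s" if "k \<in> Hom C e z" "k \<cdot> q = h" for k h z
    using that(2) in_HomD[OF that(1)] qs by (auto simp: types)
  show ?thesis
    unfolding \<epsilon>_def[symmetric] is_coequalizer_def
  proof (intro conjI allI ballI impI)
    fix Z H
    assume H: "H \<in> Hom (alg_cat C T) (b, \<beta>) Z"
      and eq: "H \<cdot>\<^bsub>alg_cat C T\<^esub> ((a, \<alpha>), f, b, \<beta>) = H \<cdot>\<^bsub>alg_cat C T\<^esub> ((a, \<alpha>), g, b, \<beta>)"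
    obtain z \<zeta> h where Z: "Z = (z, \<zeta>)" and Heq: "H = ((b, \<beta>), h, z, \<zeta>)"
      and h: "is_alg_morphism C T ((b, \<beta>), h, z, \<zeta>)"
      using H by (cases Z) (auto simp: Hom_alg_cat)
    have hf: "h \<cdot> f = h \<cdot> g" using eq Heq by simp
    show "\<exists>!k. k \<in> Hom (alg_cat C T) (e, \<epsilon>) Z \<and> k \<cdot>\<^bsub>alg_cat C T\<^esub> ((b, \<beta>), q, e, \<epsilon>) = H"
    proof (rule ex1I[of _ "((e, \<epsilon>), h \<cdot> s, (z, \<zeta>))"])
      show "((e, \<epsilon>), h \<cdot> s, (z, \<zeta>)) \<in> Hom (alg_cat C T) (e, \<epsilon>) Z \<and>
          ((e, \<epsilon>), h \<cdot> s, (z, \<zeta>)) \<cdot>\<^bsub>alg_cat C T\<^esub> ((b, \<beta>), q, e, \<epsilon>) = H"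
        using desc[OF h hf] Z Heq by simp
    next
      fix K assume K: "K \<in> Hom (alg_cat C T) (e, \<epsilon>) Z \<and> K \<cdot>\<^bsub>alg_cat C T\<^esub> ((b, \<beta>), q, e, \<epsilon>) = H"
      then obtain k where k: "K = ((e, \<epsilon>), k, (z, \<zeta>))" "is_alg_morphism C T ((e, \<epsilon>), k, (z, \<zeta>))"
        using Z by (auto simp: Hom_alg_cat)
      then show "K = ((e, \<epsilon>), h \<cdot> s, (z, \<zeta>))"
        using K Heq uniq[OF alg_morphismD(3)[OF k(2)]] by simp
    qed
  qed (use f g q_alg qf in simp_all)
qed

end

section \<open>Change of algebra structure\<close>

locale monad_map = M: monad_on C M + N: monad_on C N
  for C :: "('o, 'm) cat" (structure) and M N :: "('o, 'm) monad_data" +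
  fixes \<phi> :: "'o \<Rightarrow> 'm"
  assumes morphism: "monad_morphism C M N \<phi>"
begin

lemmas cat = M.cat

abbreviation pullback :: "'o \<times> 'm \<Rightarrow> 'o \<times> 'm" where "pullback \<equiv> pullback_alg C \<phi>"

lemma pullback_simp [simp]: "pullback (d, \<delta>) = (d, \<delta> \<cdot> \<phi> d)"
  by (simp add: pullback_alg_def)

lemma phi_nat: "nat_trans C C (endo M) (endo N) \<phi>"
  using morphism by (simp add: monad_morphism_def)

lemma phi_in_Hom: "a \<in> Obj C \<Longrightarrow> \<phi> a \<in> Hom C (M.To a) (N.To a)"
  by (rule nat_trans_Hom[OF phi_nat])

lemma phi_natural: "f \<in> Hom C a b \<Longrightarrow> \<phi> b \<cdot> M.Ta f = N.Ta f \<cdot> \<phi> a"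
  by (rule naturality[OF phi_nat])

lemma phi_mult: "a \<in> Obj C \<Longrightarrow> \<phi> a \<cdot> mult M a = mult N a \<cdot> N.Ta (\<phi> a) \<cdot> \<phi> (M.To a)"
  and phi_eta: "a \<in> Obj C \<Longrightarrow> \<phi> a \<cdot> eta M a = eta N a"
  using morphism by (simp_all add: monad_morphism_def)

lemmas map_simps = M.monad_simps N.endo in_HomD[OF N.mult_in_Hom] in_HomD[OF N.eta_in_Hom]
  in_HomD[OF phi_in_Hom]

text \<open>Multiplicativity of \<open>\<phi>\<close> turns the associativity of \<open>\<delta>\<close> into that of \<open>\<delta> \<cdot> \<phi> d\<close>.\<close>

lemma pullback_algebra:
  assumes "is_algebra C N (d, \<delta>)"
  shows "is_algebra C M (d, \<delta> \<cdot> \<phi> d)"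
proof -
  note d = N.algD[OF assms]
  note types = map_simps d(1,3-5)
  have "(\<delta> \<cdot> \<phi> d) \<cdot> mult M d = \<delta> \<cdot> \<phi> d \<cdot> mult M d" by (simp add: types)
  also have "\<dots> = (\<delta> \<cdot> mult N d) \<cdot> N.Ta (\<phi> d) \<cdot> \<phi> (M.To d)"
    unfolding phi_mult[OF d(1)] by (simp add: types)
  also have "\<dots> = \<delta> \<cdot> N.Ta (\<delta> \<cdot> \<phi> d) \<cdot> \<phi> (M.To d)"
    unfolding d(6) by (simp add: types)
  also have "N.Ta (\<delta> \<cdot> \<phi> d) \<cdot> \<phi> (M.To d) = \<phi> d \<cdot> M.Ta (\<delta> \<cdot> \<phi> d)"
    by (rule phi_natural[OF comp_in_Hom[OF cat phi_in_Hom[OF d(1)] d(2)], symmetric])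
  finally have "(\<delta> \<cdot> \<phi> d) \<cdot> mult M d = (\<delta> \<cdot> \<phi> d) \<cdot> M.Ta (\<delta> \<cdot> \<phi> d)" by (simp add: types)
  moreover have "(\<delta> \<cdot> \<phi> d) \<cdot> eta M d = Ident C d"
    using phi_eta[OF d(1)] d(7) by (simp add: types)
  ultimately show ?thesis
    using d(1) comp_in_Hom[OF cat phi_in_Hom[OF d(1)] d(2)] by (simp add: is_algebra_def)
qed

lemma pullback_alg_morphism:
  assumes "is_alg_morphism C N ((a, \<alpha>), f, (b, \<beta>))"
  shows "is_alg_morphism C M ((a, \<alpha> \<cdot> \<phi> a), f, (b, \<beta> \<cdot> \<phi> b))"
proof -
  note f = N.alg_morphismD[OF assms]
  note a = N.algD[OF f(1)] and b = N.algD[OF f(2)]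
  have "f \<cdot> \<alpha> \<cdot> \<phi> a = \<beta> \<cdot> N.Ta f \<cdot> \<phi> a"
    using extend_square[OF f(7) cat a(2) f(3) functor_Hom[OF N.endo f(3)] b(2), of "\<phi> a"] a(1)
    by (simp add: map_simps)
  also have "\<dots> = (\<beta> \<cdot> \<phi> b) \<cdot> M.Ta f"
    unfolding phi_natural[OF f(3), symmetric] using a(1) b(1,3-5) f(4-6) by (simp add: map_simps)
  finally show ?thesis
    using f(3) pullback_algebra[OF f(1)] pullback_algebra[OF f(2)] by (simp add: is_alg_morphism_def)
qed

lemma phi_star_simps [simp]:
  "on_obj (phi_star C \<phi>) A = pullback A"
  "on_arr (phi_star C \<phi>) (A, f, B) = (pullback A, f, pullback B)"
  by (simp_all add: phi_star_def)

lemma phi_star_functor: "is_functor (alg_cat C N) (alg_cat C M) (phi_star C \<phi>)"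
  unfolding is_functor_def
  by (auto simp: N.Hom_alg_cat intro: pullback_algebra pullback_alg_morphism)

text \<open>The universal property of \<open>\<phi>\<^sub>!\<close> in terms of the underlying arrows of \<open>C\<close>, without the sources
  and targets that arrows of the categories of algebras carry.\<close>

lemma universal_arrowI:
  assumes e: "is_algebra C N (e, \<epsilon>)" and u: "is_alg_morphism C M ((c, \<gamma>), u, (e, \<epsilon> \<cdot> \<phi> e))"
    and ex: "\<And>d \<delta> f. is_algebra C N (d, \<delta>) \<Longrightarrow> is_alg_morphism C M ((c, \<gamma>), f, (d, \<delta> \<cdot> \<phi> d)) \<Longrightarrow>
      \<exists>g. is_alg_morphism C N ((e, \<epsilon>), g, (d, \<delta>)) \<and> g \<cdot> u = f"
    and uniq: "\<And>d \<delta> g h. is_alg_morphism C N ((e, \<epsilon>), g, (d, \<delta>)) \<Longrightarrow>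
      is_alg_morphism C N ((e, \<epsilon>), h, (d, \<delta>)) \<Longrightarrow> g \<cdot> u = h \<cdot> u \<Longrightarrow> g = h"
  shows "universal_arrow (alg_cat C M) (alg_cat C N) (phi_star C \<phi>) (c, \<gamma>) (e, \<epsilon>)
    ((c, \<gamma>), u, pullback (e, \<epsilon>))"
  unfolding universal_arrow_def
proof (intro conjI ballI)
  fix D F assume D: "D \<in> Obj (alg_cat C N)" and F: "F \<in> Hom (alg_cat C M) (c, \<gamma>) (on_obj (phi_star C \<phi>) D)"
  obtain d \<delta> where Deq: "D = (d, \<delta>)" by fastforce
  obtain f where Feq: "F = ((c, \<gamma>), f, (d, \<delta> \<cdot> \<phi> d))" and f: "is_alg_morphism C M ((c, \<gamma>), f, (d, \<delta> \<cdot> \<phi> d))"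
    using F Deq by (auto simp: M.Hom_alg_cat)
  obtain g where g: "is_alg_morphism C N ((e, \<epsilon>), g, (d, \<delta>))" "g \<cdot> u = f"
    using ex[OF _ f] D Deq N.alg_cat_simps(1) by blast
  show "\<exists>!G. G \<in> Hom (alg_cat C N) (e, \<epsilon>) D \<and>
      on_arr (phi_star C \<phi>) G \<cdot>\<^bsub>alg_cat C M\<^esub> ((c, \<gamma>), u, pullback (e, \<epsilon>)) = F"
  proof (rule ex1I[of _ "((e, \<epsilon>), g, (d, \<delta>))"])
    fix G assume G: "G \<in> Hom (alg_cat C N) (e, \<epsilon>) D \<and>
      on_arr (phi_star C \<phi>) G \<cdot>\<^bsub>alg_cat C M\<^esub> ((c, \<gamma>), u, pullback (e, \<epsilon>)) = F"
    then obtain h where h: "G = ((e, \<epsilon>), h, (d, \<delta>))" "is_alg_morphism C N ((e, \<epsilon>), h, (d, \<delta>))"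
      using Deq by (auto simp: N.Hom_alg_cat)
    then show "G = ((e, \<epsilon>), g, (d, \<delta>))"
      using uniq[OF h(2) g(1)] G Feq g(2) by simp
  qed (use g Deq Feq in simp)
qed (use e u in simp_all)

text \<open>Morphisms \<open>M c \<rightarrow> d\<close> of \<open>M\<close>-algebras and morphisms \<open>N c \<rightarrow> d\<close> of \<open>N\<close>-algebras both correspond
  to the arrows \<open>c \<rightarrow> d\<close> of \<open>C\<close>. Composition with \<open>\<phi> c\<close> respects these correspondences because it
  carries the unit of \<open>M\<close> to that of \<open>N\<close>.\<close>

lemma universal_arrow_free:
  assumes c: "c \<in> Obj C"
  shows "universal_arrow (alg_cat C M) (alg_cat C N) (phi_star C \<phi>) (M.free c) (N.free c)
    (M.free c, \<phi> c, pullback (N.free c))"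
proof (rule universal_arrowI)
  show "is_algebra C N (N.free c)" by (rule N.free_algebra[OF c])
  have "\<phi> c \<cdot> mult M c = (mult N c \<cdot> \<phi> (N.To c)) \<cdot> M.Ta (\<phi> c)"
    unfolding phi_mult[OF c] phi_natural[OF phi_in_Hom[OF c], symmetric]
    using c by (simp add: map_simps)
  then show "is_alg_morphism C M (M.free c, \<phi> c, (N.To c, mult N c \<cdot> \<phi> (N.To c)))"
    using M.free_algebra[OF c] pullback_algebra[OF N.free_algebra[OF c]] phi_in_Hom[OF c]
    by (simp add: is_alg_morphism_def)
next
  fix d \<delta> f
  assume d: "is_algebra C N (d, \<delta>)" and f: "is_alg_morphism C M (M.free c, f, (d, \<delta> \<cdot> \<phi> d))"
  note d' = N.algD[OF d] and f' = M.alg_morphismD[OF f]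
  note types = map_simps d'(1,3-5) f'(4-6) c
  have f\<eta>: "f \<cdot> eta M c \<in> Hom C c d" by (rule comp_in_Hom[OF cat M.eta_in_Hom[OF c] f'(3)])
  have "(\<delta> \<cdot> N.Ta (f \<cdot> eta M c)) \<cdot> \<phi> c = \<delta> \<cdot> N.Ta (f \<cdot> eta M c) \<cdot> \<phi> c" by (simp add: types)
  also have "\<dots> = (\<delta> \<cdot> \<phi> d) \<cdot> M.Ta (f \<cdot> eta M c)"
    unfolding phi_natural[OF f\<eta>, symmetric] by (simp add: types)
  also have "\<dots> = f" by (rule M.morphism_from_free[OF c f])
  finally have "(\<delta> \<cdot> N.Ta (f \<cdot> eta M c)) \<cdot> \<phi> c = f" .
  with N.free_extension(1)[OF d f\<eta>]
  show "\<exists>g. is_alg_morphism C N (N.free c, g, (d, \<delta>)) \<and> g \<cdot> \<phi> c = f"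
    by (intro exI conjI)
next
  fix d \<delta> g h
  assume g: "is_alg_morphism C N (N.free c, g, (d, \<delta>))" and h: "is_alg_morphism C N (N.free c, h, (d, \<delta>))"
    and eq: "g \<cdot> \<phi> c = h \<cdot> \<phi> c"
  note g' = N.alg_morphismD[OF g] and h' = N.alg_morphismD[OF h]
  have "k \<cdot> eta N c = (k \<cdot> \<phi> c) \<cdot> eta M c" if "k \<in> Hom C (N.To c) d" for k
    using phi_eta[OF c] in_HomD[OF that] c by (simp add: map_simps)
  then have "g \<cdot> eta N c = h \<cdot> eta N c" using eq g'(3) h'(3) by simp
  then show "g = h" by (rule N.free_morphism_eqI[OF c g h])
qed

text \<open>The action of \<open>M\<close> on the right module \<open>N\<close>.\<close>

abbreviation act :: "'o \<Rightarrow> 'm" where "act c \<equiv> mult N c \<cdot> N.Ta (\<phi> c)"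

lemma act_alg_morphism:
  "c \<in> Obj C \<Longrightarrow> is_alg_morphism C N (N.free (M.To c), act c, N.free c)"
  using N.free_extension(1)[OF N.free_algebra phi_in_Hom] .

text \<open>This is the unit law of the module \<open>N\<close>. It also makes \<open>N.Ta (eta M c)\<close> a section of \<open>act c\<close>, so
  that the pair below is reflexive.\<close>

lemma act_eta:
  assumes c: "c \<in> Obj C"
  shows "act c \<cdot> N.Ta (eta M c) = Ident C (N.To c)"
proof -
  have "act c \<cdot> N.Ta (eta M c) = mult N c \<cdot> N.Ta (\<phi> c \<cdot> eta M c)" using c by (simp add: map_simps)
  then show ?thesis unfolding phi_eta[OF c] N.mult_Ta_eta[OF c] .
qed

text \<open>An arrow \<open>f : c \<rightarrow> d\<close> that is a morphism of \<open>M\<close>-algebras has an extension \<open>\<delta> \<cdot> N f : N c \<rightarrow> d\<close>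
  that coequalizes \<open>act c\<close> and \<open>N \<gamma>\<close>, hence factors through \<open>q\<close>; restricting along the unit of \<open>N\<close>
  recovers \<open>f\<close>.\<close>

lemma universal_arrow_coequalizer:
  assumes c: "is_algebra C M (c, \<gamma>)"
    and coeq: "is_coequalizer (alg_cat C N) (N.free (M.To c)) (N.free c)
      (N.free (M.To c), act c, N.free c) (N.free (M.To c), N.Ta \<gamma>, N.free c)
      (e, \<epsilon>) (N.free c, q, (e, \<epsilon>))"
  shows "universal_arrow (alg_cat C M) (alg_cat C N) (phi_star C \<phi>) (c, \<gamma>) (e, \<epsilon>)
    ((c, \<gamma>), q \<cdot> eta N c, pullback (e, \<epsilon>))"
proof (rule universal_arrowI)
  note c' = M.algD[OF c]
  have q: "is_alg_morphism C N (N.free c, q, (e, \<epsilon>))" and qeq: "q \<cdot> act c = q \<cdot> N.Ta \<gamma>"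
    using coeq by (simp_all add: is_coequalizer_def)
  note q' = N.alg_morphismD[OF q]
  show e: "is_algebra C N (e, \<epsilon>)" by (rule q'(2))
  note e' = N.algD[OF e]
  note types = map_simps c'(1,3-5) q'(4-6) e'(1,3-5)
  have q\<eta>: "q \<cdot> eta N c \<in> Hom C c e" by (rule comp_in_Hom[OF cat N.eta_in_Hom[OF c'(1)] q'(3)])
  have "(q \<cdot> eta N c) \<cdot> \<gamma> = q \<cdot> eta N c \<cdot> \<gamma>" by (simp add: types)
  also have "\<dots> = (q \<cdot> N.Ta \<gamma>) \<cdot> eta N (M.To c)"
    unfolding N.eta_natural[OF c'(2)] by (simp add: types)
  also have "\<dots> = q \<cdot> mult N c \<cdot> N.Ta (\<phi> c) \<cdot> eta N (M.To c)"
    unfolding qeq[symmetric] by (simp add: types)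
  also have "\<dots> = q \<cdot> (mult N c \<cdot> eta N (N.To c)) \<cdot> \<phi> c"
    unfolding N.eta_natural[OF phi_in_Hom[OF c'(1)], symmetric] by (simp add: types)
  also have "\<dots> = (\<epsilon> \<cdot> N.Ta (q \<cdot> eta N c)) \<cdot> \<phi> c"
    unfolding N.mult_eta[OF c'(1)] N.morphism_from_free[OF c'(1) q] by (simp add: types)
  also have "\<dots> = \<epsilon> \<cdot> N.Ta (q \<cdot> eta N c) \<cdot> \<phi> c" by (simp add: types)
  also have "\<dots> = (\<epsilon> \<cdot> \<phi> e) \<cdot> M.Ta (q \<cdot> eta N c)"
    unfolding phi_natural[OF q\<eta>, symmetric] by (simp add: types)
  finally show "is_alg_morphism C M ((c, \<gamma>), q \<cdot> eta N c, (e, \<epsilon> \<cdot> \<phi> e))"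
    using c pullback_algebra[OF e] q\<eta> by (simp add: is_alg_morphism_def)
  have coeq_ump: "\<exists>!k. k \<in> Hom (alg_cat C N) (e, \<epsilon>) (d, \<delta>) \<and>
        k \<cdot>\<^bsub>alg_cat C N\<^esub> (N.free c, q, (e, \<epsilon>)) = (N.free c, h, (d, \<delta>))"
    if "is_alg_morphism C N (N.free c, h, (d, \<delta>))" "h \<cdot> act c = h \<cdot> N.Ta \<gamma>" for h d \<delta>
    using coeq that by (simp add: is_coequalizer_def)
  fix d \<delta>
  {
    fix f assume d: "is_algebra C N (d, \<delta>)" and f: "is_alg_morphism C M ((c, \<gamma>), f, (d, \<delta> \<cdot> \<phi> d))"
    note d' = N.algD[OF d] and f' = M.alg_morphismD[OF f]
    note types = types d'(1,3-5) f'(4-6)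
    have "(\<delta> \<cdot> N.Ta f) \<cdot> act c = \<delta> \<cdot> (N.Ta f \<cdot> mult N c) \<cdot> N.Ta (\<phi> c)" by (simp add: types)
    also have "\<dots> = (\<delta> \<cdot> mult N d) \<cdot> N.Ta (N.Ta f \<cdot> \<phi> c)"
      unfolding N.mult_natural[OF f'(3), symmetric] by (simp add: types)
    also have "\<dots> = \<delta> \<cdot> N.Ta ((\<delta> \<cdot> \<phi> d) \<cdot> M.Ta f)"
      unfolding d'(6) phi_natural[OF f'(3), symmetric] by (simp add: types)
    also have "\<dots> = (\<delta> \<cdot> N.Ta f) \<cdot> N.Ta \<gamma>"
      unfolding f'(7)[symmetric] by (simp add: types)
    finally have eq: "(\<delta> \<cdot> N.Ta f) \<cdot> act c = (\<delta> \<cdot> N.Ta f) \<cdot> N.Ta \<gamma>" .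
    obtain g where g: "is_alg_morphism C N ((e, \<epsilon>), g, (d, \<delta>))" "g \<cdot> q = \<delta> \<cdot> N.Ta f"
      using ex1_implies_ex[OF coeq_ump[OF N.free_extension(1)[OF d f'(3)] eq]]
      by (clarsimp simp: N.Hom_alg_cat)
    have "g \<cdot> q \<cdot> eta N c = (g \<cdot> q) \<cdot> eta N c"
      using N.alg_morphismD(4-6)[OF g(1)] by (simp add: types)
    also have "\<dots> = f" unfolding g(2) by (rule N.free_extension(2)[OF d f'(3)])
    finally have "g \<cdot> q \<cdot> eta N c = f" .
    with g(1) show "\<exists>g. is_alg_morphism C N ((e, \<epsilon>), g, (d, \<delta>)) \<and> g \<cdot> q \<cdot> eta N c = f"
      by (intro exI conjI)
  }
  {
    fix g h
    assume g: "is_alg_morphism C N ((e, \<epsilon>), g, (d, \<delta>))" and h: "is_alg_morphism C N ((e, \<epsilon>), h, (d, \<delta>))"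
      and eq: "g \<cdot> q \<cdot> eta N c = h \<cdot> q \<cdot> eta N c"
    note g' = N.alg_morphismD[OF g] and h' = N.alg_morphismD[OF h]
    note gq = N.alg_morphism_comp[OF q g] and hq = N.alg_morphism_comp[OF q h]
    have "(g \<cdot> q) \<cdot> eta N c = (h \<cdot> q) \<cdot> eta N c"
      using eq g'(4-6) h'(4-6) by (simp add: types)
    then have same: "g \<cdot> q = h \<cdot> q" by (rule N.free_morphism_eqI[OF c'(1) gq hq])
    have "(g \<cdot> q) \<cdot> act c = g \<cdot> q \<cdot> act c" using g'(4-6) by (simp add: types)
    also have "\<dots> = (g \<cdot> q) \<cdot> N.Ta \<gamma>" unfolding qeq using g'(4-6) by (simp add: types)
    finally have ump: "\<exists>!k. k \<in> Hom (alg_cat C N) (e, \<epsilon>) (d, \<delta>) \<and>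
        k \<cdot>\<^bsub>alg_cat C N\<^esub> (N.free c, q, (e, \<epsilon>)) = (N.free c, g \<cdot> q, (d, \<delta>))" (is "\<exists>!k. ?P k")
      by (rule coeq_ump[OF gq])
    have "?P ((e, \<epsilon>), g, (d, \<delta>))" "?P ((e, \<epsilon>), h, (d, \<delta>))"
      using g h same by simp_all
    then have "((e, \<epsilon>), g, (d, \<delta>)) = ((e, \<epsilon>), h, (d, \<delta>))"
      using ump by blast
    then show "g = h" by simp
  }
qed

text \<open>A coequalizer exists because \<open>act c\<close> and \<open>N \<gamma>\<close> have the common section \<open>N (eta M c)\<close>.\<close>

lemma phi_shriek_left_adjoint:
  assumes "has_reflexive_coequalizers (alg_cat C N)"
  shows "left_adjoint (alg_cat C M) (alg_cat C N) (phi_shriek C M N \<phi>) (phi_star C \<phi>)"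
  unfolding phi_shriek_def
proof (rule someI_ex, rule left_adjoint_if_universal_arrows[OF M.category_alg_cat N.category_alg_cat phi_star_functor])
  fix A assume "A \<in> Obj (alg_cat C M)"
  then obtain c \<gamma> where A: "A = (c, \<gamma>)" and c: "is_algebra C M (c, \<gamma>)" by (cases A) auto
  note c' = M.algD[OF c]
  note types = map_simps c'(1,3-5)
  let ?r = "(N.free (M.To c), act c, N.free c)" and ?s = "(N.free (M.To c), N.Ta \<gamma>, N.free c)"
  have "N.Ta \<gamma> \<cdot> N.Ta (eta M c) = N.Ta (\<gamma> \<cdot> eta M c)" by (simp add: types)
  then have "N.Ta \<gamma> \<cdot> N.Ta (eta M c) = Ident C (N.To c)" unfolding c'(7) by (simp add: types)
  then have "reflexive_pair (alg_cat C N) (N.free (M.To c)) (N.free c) ?r ?s"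
    unfolding reflexive_pair_def
    using act_alg_morphism[OF c'(1)] N.Ta_alg_morphism[OF c'(2)] act_eta[OF c'(1)]
      N.Ta_alg_morphism[OF M.eta_in_Hom[OF c'(1)]]
    by (intro conjI bexI[of _ "(N.free c, N.Ta (eta M c), N.free (M.To c))"]) simp_all
  then obtain E Q where EQ: "is_coequalizer (alg_cat C N) (N.free (M.To c)) (N.free c) ?r ?s E Q"
    using assms unfolding has_reflexive_coequalizers_def by blast
  then have "Q \<in> Hom (alg_cat C N) (N.free c) E" by (simp add: is_coequalizer_def)
  then obtain e \<epsilon> q where "E = (e, \<epsilon>)" "Q = (N.free c, q, (e, \<epsilon>))" 
    by (cases E) (auto simp: N.Hom_alg_cat)
  then show "\<exists>B u. universal_arrow (alg_cat C M) (alg_cat C N) (phi_star C \<phi>) A B u"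
    using universal_arrow_coequalizer[OF c] EQ unfolding A by (intro exI) simp
qed

section \<open>The PBW property and freeness\<close>

lemma act_in_Hom: "c \<in> Obj C \<Longrightarrow> act c \<in> Hom C (N.To (M.To c)) (N.To c)"
  by (rule N.alg_morphismD(3)[OF act_alg_morphism])

lemma right_module_via: "right_module C M (module_via C N \<phi>)"
proof -
  have "act b \<cdot> N.Ta (M.Ta f) = N.Ta f \<cdot> act a" if f: "f \<in> Hom C a b" for a b f
  proof -
    note types = map_simps Hom_objs[OF cat f] in_HomD[OF f]
    have "act b \<cdot> N.Ta (M.Ta f) = mult N b \<cdot> N.Ta (\<phi> b \<cdot> M.Ta f)" by (simp add: types)
    also have "\<dots> = (mult N b \<cdot> N.Ta (N.Ta f)) \<cdot> N.Ta (\<phi> a)"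
      unfolding phi_natural[OF f] by (simp add: types)
    also have "\<dots> = N.Ta f \<cdot> act a"
      unfolding N.mult_natural[OF f] by (simp add: types)
    finally show ?thesis .
  qed
  moreover have "act a \<cdot> act (M.To a) = act a \<cdot> N.Ta (mult M a)" if a: "a \<in> Obj C" for a
  proof -
    note types = map_simps a
    note f = N.alg_morphismD[OF act_alg_morphism[OF a]]
    have "act a \<cdot> act (M.To a) = (act a \<cdot> mult N (M.To a)) \<cdot> N.Ta (\<phi> (M.To a))" by (simp add: types)
    also have "\<dots> = (mult N a \<cdot> N.Ta (act a)) \<cdot> N.Ta (\<phi> (M.To a))" unfolding f(7) ..
    also have "\<dots> = (mult N a \<cdot> N.Ta (mult N a)) \<cdot> N.Ta (N.Ta (\<phi> a) \<cdot> \<phi> (M.To a))"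
      by (simp add: types)
    also have "\<dots> = mult N a \<cdot> N.Ta (mult N a \<cdot> N.Ta (\<phi> a) \<cdot> \<phi> (M.To a))"
      by (simp add: types)
    also have "\<dots> = act a \<cdot> N.Ta (mult M a)"
      unfolding phi_mult[OF a, symmetric] by (simp add: types)
    finally show ?thesis .
  qed
  ultimately show ?thesis
    using act_in_Hom act_eta N.endo
    by (simp add: right_module_def module_via_def nat_trans_def)
qed

lemma is_free_right_moduleI:
  assumes X: "is_endofunctor C X"
    and natural: "\<And>a b f. f \<in> Hom C a b \<Longrightarrow> \<sigma> b \<cdot> N.Ta f = on_arr X (M.Ta f) \<cdot> \<sigma> a"
    and linear: "\<And>a. a \<in> Obj C \<Longrightarrow> \<sigma> a \<cdot> act a = on_arr X (mult M a) \<cdot> \<sigma> (M.To a)"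
    and iso: "\<And>a. a \<in> Obj C \<Longrightarrow> is_iso C (N.To a) (on_obj X (M.To a)) (\<sigma> a)"
  shows "is_free_right_module C M (module_via C N \<phi>)"
proof -
  have "\<exists>t. \<forall>a\<in>Obj C. t a \<in> Hom C (on_obj X (M.To a)) (N.To a) \<and>
      t a \<cdot> \<sigma> a = Ident C (N.To a) \<and> \<sigma> a \<cdot> t a = Ident C (on_obj X (M.To a))"
  proof (rule bchoice, rule ballI)
    fix a assume "a \<in> Obj C"
    from iso[OF this]
    show "\<exists>t. t \<in> Hom C (on_obj X (M.To a)) (N.To a) \<and>
      t \<cdot> \<sigma> a = Ident C (N.To a) \<and> \<sigma> a \<cdot> t = Ident C (on_obj X (M.To a))"
      unfolding is_iso_def by (elim conjE bexE) (intro exI conjI)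
  qed
  then obtain \<tau> where \<tau>: "\<And>a. a \<in> Obj C \<Longrightarrow> \<tau> a \<in> Hom C (on_obj X (M.To a)) (N.To a)"
    and \<tau>\<sigma>: "\<And>a. a \<in> Obj C \<Longrightarrow> \<tau> a \<cdot> \<sigma> a = Ident C (N.To a)"
    and \<sigma>\<tau>: "\<And>a. a \<in> Obj C \<Longrightarrow> \<sigma> a \<cdot> \<tau> a = Ident C (on_obj X (M.To a))"
    by blast
  have \<sigma>: "\<sigma> a \<in> Hom C (N.To a) (on_obj X (M.To a))" if "a \<in> Obj C" for a
    using iso[OF that] by (simp add: is_iso_def)
  have nat': "\<tau> b \<cdot> on_arr X (M.Ta f) = N.Ta f \<cdot> \<tau> a" if f: "f \<in> Hom C a b" for a b f
  proof -
    note a = Hom_objs(1)[OF cat f] and b = Hom_objs(2)[OF cat f]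
    show ?thesis
      by (rule inverse_square[OF cat \<sigma>[OF a] \<tau>[OF a] \<sigma>\<tau>[OF a] \<sigma>[OF b] \<tau>[OF b] \<tau>\<sigma>[OF b]
            functor_Hom[OF N.endo f] functor_Hom[OF X functor_Hom[OF M.endo f]] natural[OF f]])
  qed
  have lin': "\<tau> a \<cdot> on_arr X (mult M a) = act a \<cdot> \<tau> (M.To a)" if a: "a \<in> Obj C" for a
  proof -
    have Ma: "M.To a \<in> Obj C" by (rule functor_obj[OF M.endo a])
    show ?thesis
      by (rule inverse_square[OF cat \<sigma>[OF Ma] \<tau>[OF Ma] \<sigma>\<tau>[OF Ma] \<sigma>[OF a] \<tau>[OF a] \<tau>\<sigma>[OF a]
            act_in_Hom[OF a] functor_Hom[OF X M.mult_in_Hom[OF a]] linear[OF a]])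
  qed
  have "module_isomorphic C M (module_via C N \<phi>) (free_module M X)"
    unfolding module_isomorphic_def module_hom_def module_via_def free_module_def nat_trans_def
    using \<sigma> \<tau> \<tau>\<sigma> \<sigma>\<tau> natural linear nat' lin'
    by (intro exI[of _ \<sigma>] exI[of _ \<tau>]) simp
  then show ?thesis
    unfolding is_free_right_module_def using right_module_via X by blast
qed


text \<open>Here \<open>\<kappa> i\<close> is the comparison \<open>\<phi>\<^sub>!(M i) \<cong> N i\<close>, and \<open>\<sigma> i\<close> is the composite isomorphism
  \<open>N i \<cong> \<phi>\<^sub>!(M i) \<cong> X M i\<close>. Its compatibility with arbitrary pairs of morphisms \<open>h\<close>, \<open>l\<close> of free
  algebras that correspond along \<open>\<phi>\<close> yields both naturality (\<open>h = M f\<close>) and linearity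
  (\<open>h = mult M a\<close>).\<close>

lemma free_if_PBW:
  assumes coeq: "has_reflexive_coequalizers (alg_cat C N)" and PBW: "PBW_property C M N \<phi>"
  shows "is_free_right_module C M (module_via C N \<phi>)"
proof -
  let ?F = "phi_shriek C M N \<phi>"
  let ?UF = "forget \<odot> ?F"
  obtain X \<tau> where X: "is_endofunctor C X" and \<tau>: "nat_iso (alg_cat C M) C ?UF (X \<odot> forget) \<tau>"
    using PBW unfolding PBW_property_def by blast
  have \<tau>_nat: "nat_trans (alg_cat C M) C ?UF (X \<odot> forget) \<tau>"
    and \<tau>_iso: "\<And>A. is_algebra C M A \<Longrightarrow> is_iso C (on_obj ?UF A) (on_obj X (fst A)) (\<tau> A)"
    using \<tau> by (simp_all add: nat_iso_def del: split_paired_All)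
  note adj = phi_shriek_left_adjoint[OF coeq]
  have F: "is_functor (alg_cat C M) (alg_cat C N) ?F" using adj by (simp add: left_adjoint_def)
  have free_obj: "M.free i \<in> Obj (alg_cat C M)" if "i \<in> Obj C" for i
    using M.free_algebra[OF that] by simp
  obtain K where K_iso: "\<And>i. i \<in> Obj C \<Longrightarrow> is_iso (alg_cat C N) (on_obj ?F (M.free i)) (N.free i) (K i)"
    and K: "\<forall>i\<in>Obj C. \<forall>j\<in>Obj C. \<forall>h\<in>Hom (alg_cat C M) (M.free i) (M.free j).
       \<forall>l\<in>Hom (alg_cat C N) (N.free i) (N.free j).
       on_arr (phi_star C \<phi>) l \<cdot>\<^bsub>alg_cat C M\<^esub> (M.free i, \<phi> i, pullback (N.free i)) =
         (M.free j, \<phi> j, pullback (N.free j)) \<cdot>\<^bsub>alg_cat C M\<^esub> h \<longrightarrow>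
       K j \<cdot>\<^bsub>alg_cat C N\<^esub> on_arr ?F h = l \<cdot>\<^bsub>alg_cat C N\<^esub> K i"
    using left_adjoint_comparison[OF M.category_alg_cat N.category_alg_cat adj,
        where I="Obj C" and A=M.free and L=N.free, OF free_obj universal_arrow_free]
    by blast
  define \<kappa> where "\<kappa> i = on_arr forget (K i)" for i
  have \<kappa>_iso: "is_iso C (on_obj ?UF (M.free i)) (N.To i) (\<kappa> i)" if "i \<in> Obj C" for i
    using functor_preserves_iso[OF N.category_alg_cat N.forget_functor K_iso[OF that]]
    by (simp add: \<kappa>_def)
  have "\<exists>k. \<forall>i\<in>Obj C. is_iso C (N.To i) (on_obj ?UF (M.free i)) (k i) \<and>
      k i \<cdot> \<kappa> i = Ident C (on_obj ?UF (M.free i)) \<and> \<kappa> i \<cdot> k i = Ident C (N.To i)"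
  proof (rule bchoice, rule ballI)
    fix i assume i: "i \<in> Obj C"
    obtain k where "is_iso C (N.To i) (on_obj ?UF (M.free i)) k"
      "k \<cdot> \<kappa> i = Ident C (on_obj ?UF (M.free i))" "\<kappa> i \<cdot> k = Ident C (N.To i)"
      using iso_inverse[OF \<kappa>_iso[OF i]] .
    then show "\<exists>k. is_iso C (N.To i) (on_obj ?UF (M.free i)) k \<and>
      k \<cdot> \<kappa> i = Ident C (on_obj ?UF (M.free i)) \<and> \<kappa> i \<cdot> k = Ident C (N.To i)"
      by (intro exI conjI)
  qed
  then obtain \<kappa>' where \<kappa>'_iso: "\<And>i. i \<in> Obj C \<Longrightarrow> is_iso C (N.To i) (on_obj ?UF (M.free i)) (\<kappa>' i)"
    and \<kappa>'\<kappa>: "\<And>i. i \<in> Obj C \<Longrightarrow> \<kappa>' i \<cdot> \<kappa> i = Ident C (on_obj ?UF (M.free i))"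
    and \<kappa>\<kappa>': "\<And>i. i \<in> Obj C \<Longrightarrow> \<kappa> i \<cdot> \<kappa>' i = Ident C (N.To i)"
    by blast
  have \<kappa>: "\<kappa> i \<in> Hom C (on_obj ?UF (M.free i)) (N.To i)"
    and \<kappa>': "\<kappa>' i \<in> Hom C (N.To i) (on_obj ?UF (M.free i))"
    and \<tau>_free: "\<tau> (M.free i) \<in> Hom C (on_obj ?UF (M.free i)) (on_obj X (M.To i))"
    if "i \<in> Obj C" for i
    using \<kappa>_iso[OF that] \<kappa>'_iso[OF that] \<tau>_iso[OF M.free_algebra[OF that]] by (simp_all add: is_iso_def)
  define \<sigma> where "\<sigma> i = \<tau> (M.free i) \<cdot> \<kappa>' i" for i
  have square: "\<sigma> j \<cdot> l = on_arr X h \<cdot> \<sigma> i"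
    if i: "i \<in> Obj C" and j: "j \<in> Obj C" and h: "is_alg_morphism C M (M.free i, h, M.free j)"
      and l: "is_alg_morphism C N (N.free i, l, N.free j)" and lh: "l \<cdot> \<phi> i = \<phi> j \<cdot> h" for i j h l
  proof -
    define P where "P = on_arr ?UF (M.free i, h, M.free j)"
    have hH: "(M.free i, h, M.free j) \<in> Hom (alg_cat C M) (M.free i) (M.free j)" using h by simp
    have P: "P \<in> Hom C (on_obj ?UF (M.free i)) (on_obj ?UF (M.free j))"
      using functor_Hom[OF N.forget_functor functor_Hom[OF F hH]] by (simp add: P_def)
    have "K j \<cdot>\<^bsub>alg_cat C N\<^esub> on_arr ?F (M.free i, h, M.free j) = (N.free i, l, N.free j) \<cdot>\<^bsub>alg_cat C N\<^esub> K i"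
      using K[rule_format, OF i j hH, of "(N.free i, l, N.free j)"] l lh by simp
    moreover have "K j \<in> Hom (alg_cat C N) (on_obj ?F (M.free j)) (N.free j)"
      "K i \<in> Hom (alg_cat C N) (on_obj ?F (M.free i)) (N.free i)"
      using K_iso[OF i] K_iso[OF j] by (simp_all add: is_iso_def)
    ultimately have "\<kappa> j \<cdot> P = l \<cdot> \<kappa> i"
      using functor_Hom[OF F hH] by (auto simp: N.Hom_alg_cat \<kappa>_def P_def)
    then have \<kappa>'_square: "\<kappa>' j \<cdot> l = P \<cdot> \<kappa>' i"
      using inverse_square[OF cat \<kappa>[OF i] \<kappa>'[OF i] \<kappa>\<kappa>'[OF i] \<kappa>[OF j] \<kappa>'[OF j] \<kappa>'\<kappa>[OF j] P] l
        N.alg_morphismD(3) by blast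
    have \<tau>_square: "\<tau> (M.free j) \<cdot> P = on_arr X h \<cdot> \<tau> (M.free i)"
      using naturality[OF \<tau>_nat hH] by (simp add: P_def)
    note types = cat cat_simps in_HomD[OF \<tau>_free[OF i]] in_HomD[OF \<tau>_free[OF j]] in_HomD[OF \<kappa>'[OF i]]
      in_HomD[OF \<kappa>'[OF j]] in_HomD[OF P] N.alg_morphismD(4-6)[OF l] M.alg_morphismD(4-6)[OF h]
      X endo_simps
    have "\<sigma> j \<cdot> l = \<tau> (M.free j) \<cdot> \<kappa>' j \<cdot> l" unfolding \<sigma>_def by (simp add: types)
    also have "\<dots> = (\<tau> (M.free j) \<cdot> P) \<cdot> \<kappa>' i" unfolding \<kappa>'_square by (simp add: types)
    also have "\<dots> = on_arr X h \<cdot> \<sigma> i" unfolding \<tau>_square \<sigma>_def by (simp add: types)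
    finally show ?thesis .
  qed
  show ?thesis
  proof (rule is_free_right_moduleI[OF X, of \<sigma>])
    fix a b f assume f: "f \<in> Hom C a b"
    show "\<sigma> b \<cdot> N.Ta f = on_arr X (M.Ta f) \<cdot> \<sigma> a"
      by (rule square[OF Hom_objs[OF cat f] M.Ta_alg_morphism[OF f] N.Ta_alg_morphism[OF f]
            phi_natural[OF f, symmetric]])
  next
    fix a assume a: "a \<in> Obj C"
    \<comment> \<open>\<open>mult M a\<close> is itself a morphism of free algebras, and \<open>\<phi>\<close> being multiplicative says
      exactly that it corresponds to \<open>act a\<close>.\<close>
    have Ma: "M.To a \<in> Obj C" by (rule functor_obj[OF M.endo a])
    have "is_alg_morphism C M (M.free (M.To a), mult M a, M.free a)"
      using M.free_algebra[OF Ma] M.free_algebra[OF a] M.mult_in_Hom[OF a] M.mult_mult[OF a]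
      by (simp add: is_alg_morphism_def)
    moreover have "act a \<cdot> \<phi> (M.To a) = \<phi> a \<cdot> mult M a"
      unfolding phi_mult[OF a] using a by (simp add: map_simps)
    ultimately show "\<sigma> a \<cdot> act a = on_arr X (mult M a) \<cdot> \<sigma> (M.To a)"
      by (rule square[OF Ma a _ act_alg_morphism[OF a]])
  next
    fix a assume a: "a \<in> Obj C"
    show "is_iso C (N.To a) (on_obj X (M.To a)) (\<sigma> a)"
      unfolding \<sigma>_def using iso_comp[OF cat \<kappa>'_iso[OF a]] \<tau>_iso[OF M.free_algebra[OF a]] by simp
  qed
qed

text \<open>The splitting is the canonical one of \<open>\<gamma> : M c \<rightarrow> c\<close>, with sections given by units of \<open>M\<close>, after
  applying \<open>X\<close> and conjugating with \<open>X M \<cong> N\<close>. In the proof, \<open>q\<close> and \<open>s\<close> are the transported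
  \<open>\<gamma>\<close> and \<open>eta M c\<close>, and \<open>\<nu>\<close> is the resulting \<open>N\<close>-action on \<open>X c\<close>. Every piece is natural, so
  \<open>X h\<close> is a morphism of \<open>N\<close>-algebras for each morphism \<open>h\<close> of \<open>M\<close>-algebras.\<close>

lemma PBW_if_free:
  assumes coeq: "has_reflexive_coequalizers (alg_cat C N)"
    and free: "is_free_right_module C M (module_via C N \<phi>)"
  shows "PBW_property C M N \<phi>"
proof -
  let ?F = "phi_shriek C M N \<phi>"
  obtain X \<sigma> \<tau> where X: "is_endofunctor C X"
    and \<sigma>_hom: "module_hom C M (module_via C N \<phi>) (free_module M X) \<sigma>"
    and \<tau>_hom: "module_hom C M (free_module M X) (module_via C N \<phi>) \<tau>"
    and inv: "\<forall>a\<in>Obj C. \<tau> a \<cdot> \<sigma> a = Ident C (on_obj (carrier_functor (module_via C N \<phi>)) a) \<and>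
      \<sigma> a \<cdot> \<tau> a = Ident C (on_obj (carrier_functor (free_module M X)) a)"
    using free unfolding is_free_right_module_def module_isomorphic_def by blast
  let ?X = "on_arr X"
  have \<sigma>: "\<sigma> a \<in> Hom C (N.To a) (on_obj X (M.To a))" and \<tau>: "\<tau> a \<in> Hom C (on_obj X (M.To a)) (N.To a)"
    and \<tau>\<sigma>: "\<tau> a \<cdot> \<sigma> a = Ident C (N.To a)" and \<sigma>\<tau>: "\<sigma> a \<cdot> \<tau> a = Ident C (on_obj X (M.To a))"
    and \<sigma>_act: "\<sigma> a \<cdot> act a = ?X (mult M a) \<cdot> \<sigma> (M.To a)"
    and \<tau>_act: "\<tau> a \<cdot> ?X (mult M a) = act a \<cdot> \<tau> (M.To a)" if "a \<in> Obj C" for a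
    using \<sigma>_hom \<tau>_hom inv that
    by (simp_all add: module_hom_def module_via_def free_module_def nat_trans_def)
  have \<sigma>_nat: "\<sigma> b \<cdot> N.Ta f = ?X (M.Ta f) \<cdot> \<sigma> a" and \<tau>_nat: "\<tau> b \<cdot> ?X (M.Ta f) = N.Ta f \<cdot> \<tau> a"
    if "f \<in> Hom C a b" for a b f
    using \<sigma>_hom \<tau>_hom that
    by (simp_all add: module_hom_def module_via_def free_module_def nat_trans_def)
  note map_simps' = map_simps X in_HomD[OF \<sigma>] in_HomD[OF \<tau>]
  define q where "q A = ?X (snd A) \<cdot> \<sigma> (fst A)" for A
  define s where "s c = \<tau> c \<cdot> ?X (eta M c)" for c
  define \<nu> where "\<nu> A = q A \<cdot> mult N (fst A) \<cdot> N.Ta (s (fst A))" for A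
  define L where "L A = (on_obj X (fst A), \<nu> A)" for A
  have s: "s c \<in> Hom C (on_obj X c) (N.To c)" if "c \<in> Obj C" for c
    unfolding s_def by (rule in_HomI) (use that in \<open>simp_all add: map_simps'\<close>)
  have s_nat: "s c' \<cdot> ?X h = N.Ta h \<cdot> s c" if h: "h \<in> Hom C c c'" for h c c'
  proof -
    note types = map_simps' Hom_objs[OF cat h] in_HomD[OF h]
    have "s c' \<cdot> ?X h = \<tau> c' \<cdot> ?X (eta M c' \<cdot> h)" unfolding s_def by (simp add: types)
    also have "\<dots> = (\<tau> c' \<cdot> ?X (M.Ta h)) \<cdot> ?X (eta M c)"
      unfolding M.eta_natural[OF h] by (simp add: types)
    also have "\<dots> = N.Ta h \<cdot> s c"
      unfolding \<tau>_nat[OF h] s_def by (simp add: types)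
    finally show ?thesis .
  qed
  have q: "q (c, \<gamma>) \<in> Hom C (N.To c) (on_obj X c)" if "is_algebra C M (c, \<gamma>)" for c \<gamma>
    unfolding q_def by (rule in_HomI) (use M.algD(1,3-5)[OF that] in \<open>simp_all add: map_simps'\<close>)
  have q_nat: "q (c', \<gamma>') \<cdot> N.Ta h = ?X h \<cdot> q (c, \<gamma>)"
    if h: "is_alg_morphism C M ((c, \<gamma>), h, (c', \<gamma>'))" for c \<gamma> h c' \<gamma>'
  proof -
    note h' = M.alg_morphismD[OF h]
    note types = map_simps' h'(4-6) M.algD(1,3-5)[OF h'(1)] M.algD(1,3-5)[OF h'(2)]
    have "q (c', \<gamma>') \<cdot> N.Ta h = ?X \<gamma>' \<cdot> \<sigma> c' \<cdot> N.Ta h" unfolding q_def by (simp add: types)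
    also have "\<dots> = ?X (\<gamma>' \<cdot> M.Ta h) \<cdot> \<sigma> c" unfolding \<sigma>_nat[OF h'(3)] by (simp add: types)
    also have "\<dots> = ?X h \<cdot> q (c, \<gamma>)" unfolding h'(7)[symmetric] q_def by (simp add: types)
    finally show ?thesis .
  qed
  have split_coeq: "is_coequalizer (alg_cat C N) (N.free (M.To c)) (N.free c)
      (N.free (M.To c), act c, N.free c) (N.free (M.To c), N.Ta \<gamma>, N.free c)
      (L (c, \<gamma>)) (N.free c, q (c, \<gamma>), L (c, \<gamma>))" if A: "is_algebra C M (c, \<gamma>)" for c \<gamma>
  proof -
    note c = M.algD[OF A]
    have Mc: "M.To c \<in> Obj C" by (rule functor_obj[OF M.endo c(1)])
    note types = map_simps' c(1,3-5)
    define t where "t = s (M.To c) \<cdot> \<sigma> c"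
    have t: "t \<in> Hom C (N.To c) (N.To (M.To c))"
      unfolding t_def by (rule comp_in_Hom[OF cat \<sigma>[OF c(1)] s[OF Mc]])
    have "q (c, \<gamma>) \<cdot> act c = ?X \<gamma> \<cdot> \<sigma> c \<cdot> act c" unfolding q_def by (simp add: types)
    also have "\<dots> = ?X (\<gamma> \<cdot> mult M c) \<cdot> \<sigma> (M.To c)"
      unfolding \<sigma>_act[OF c(1)] by (simp add: types)
    also have "\<dots> = ?X \<gamma> \<cdot> ?X (M.Ta \<gamma>) \<cdot> \<sigma> (M.To c)" unfolding c(6) by (simp add: types)
    also have "\<dots> = q (c, \<gamma>) \<cdot> N.Ta \<gamma>"
      unfolding \<sigma>_nat[OF c(2), symmetric] q_def by (simp add: types)
    finally have q_eq: "q (c, \<gamma>) \<cdot> act c = q (c, \<gamma>) \<cdot> N.Ta \<gamma>" .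
    have "q (c, \<gamma>) \<cdot> s c = ?X \<gamma> \<cdot> (\<sigma> c \<cdot> \<tau> c) \<cdot> ?X (eta M c)"
      unfolding q_def s_def by (simp add: types)
    also have "\<dots> = ?X (\<gamma> \<cdot> eta M c)" unfolding \<sigma>\<tau>[OF c(1)] by (simp add: types)
    also have "\<dots> = Ident C (on_obj X c)" unfolding c(7) by (simp add: types)
    finally have qs: "q (c, \<gamma>) \<cdot> s c = Ident C (on_obj X c)" .
    have "act c \<cdot> t = (act c \<cdot> \<tau> (M.To c)) \<cdot> ?X (eta M (M.To c)) \<cdot> \<sigma> c"
      unfolding t_def s_def by (simp add: types)
    also have "\<dots> = \<tau> c \<cdot> ?X (mult M c \<cdot> eta M (M.To c)) \<cdot> \<sigma> c"
      unfolding \<tau>_act[OF c(1), symmetric] by (simp add: types)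
    also have "\<dots> = Ident C (N.To c)"
      unfolding M.mult_eta[OF c(1)] using \<tau>\<sigma>[OF c(1)] by (simp add: types)
    finally have act_t: "act c \<cdot> t = Ident C (N.To c)" .
    have "N.Ta \<gamma> \<cdot> t = (N.Ta \<gamma> \<cdot> s (M.To c)) \<cdot> \<sigma> c"
      unfolding t_def using in_HomD[OF s[OF Mc]] by (simp add: types)
    also have "\<dots> = s c \<cdot> q (c, \<gamma>)"
      unfolding s_nat[OF c(2), symmetric] q_def using in_HomD[OF s[OF c(1)]] by (simp add: types)
    finally have \<gamma>_t: "N.Ta \<gamma> \<cdot> t = s c \<cdot> q (c, \<gamma>)" .
    show ?thesis
      using N.coequalizer_of_split_pair[OF act_alg_morphism[OF c(1)] N.Ta_alg_morphism[OF c(2)]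
          q[OF A] s[OF c(1)] t q_eq qs act_t \<gamma>_t]
      by (simp add: L_def \<nu>_def)
  qed
  define u where "u A = (A, q A \<cdot> eta N (fst A), pullback (L A))" for A
  have univ: "universal_arrow (alg_cat C M) (alg_cat C N) (phi_star C \<phi>) A (L A) (u A)"
    if "A \<in> Obj (alg_cat C M)" for A
  proof (cases A)
    case (Pair c \<gamma>)
    then have A: "is_algebra C M (c, \<gamma>)" using that by simp
    show ?thesis
      using universal_arrow_coequalizer[OF A split_coeq[OF A, unfolded L_def fst_conv]]
      by (simp add: Pair u_def L_def)
  qed
  note adj = phi_shriek_left_adjoint[OF coeq]
  have F: "is_functor (alg_cat C M) (alg_cat C N) ?F" using adj by (simp add: left_adjoint_def)
  obtain K where K_iso: "\<And>A. A \<in> Obj (alg_cat C M) \<Longrightarrow> is_iso (alg_cat C N) (on_obj ?F A) (L A) (K A)"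
    and K: "\<forall>A\<in>Obj (alg_cat C M). \<forall>B\<in>Obj (alg_cat C M). \<forall>h\<in>Hom (alg_cat C M) A B.
       \<forall>l\<in>Hom (alg_cat C N) (L A) (L B).
       on_arr (phi_star C \<phi>) l \<cdot>\<^bsub>alg_cat C M\<^esub> u A = u B \<cdot>\<^bsub>alg_cat C M\<^esub> h \<longrightarrow>
       K B \<cdot>\<^bsub>alg_cat C N\<^esub> on_arr ?F h = l \<cdot>\<^bsub>alg_cat C N\<^esub> K A"
    using left_adjoint_comparison[OF M.category_alg_cat N.category_alg_cat adj,
        where I="Obj (alg_cat C M)" and A="\<lambda>A. A" and L=L and u=u, OF _ univ]
    by blast
  define \<kappa> where "\<kappa> A = on_arr forget (K A)" for A
  have \<kappa>_iso: "is_iso C (on_obj (forget \<odot> ?F) A) (on_obj (X \<odot> forget) A) (\<kappa> A)"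
    if "A \<in> Obj (alg_cat C M)" for A
    using functor_preserves_iso[OF N.category_alg_cat N.forget_functor K_iso[OF that]]
    by (simp add: \<kappa>_def L_def)
  have \<kappa>_nat: "\<kappa> B \<cdot> on_arr (forget \<odot> ?F) H = on_arr (X \<odot> forget) H \<cdot> \<kappa> A"
    if H: "H \<in> Hom (alg_cat C M) A B" for A B H
  proof -
    obtain c \<gamma> where Aeq: "A = (c, \<gamma>)" by fastforce
    obtain c' \<gamma>' where Beq: "B = (c', \<gamma>')" by fastforce
    obtain h where Heq: "H = (A, h, B)" and h: "is_alg_morphism C M ((c, \<gamma>), h, (c', \<gamma>'))"
      using H Aeq Beq by (auto simp: M.Hom_alg_cat)
    note h' = M.alg_morphismD[OF h]
    note c = M.algD[OF h'(1)] and d = M.algD[OF h'(2)]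
    note types = map_simps' c(1,3-5) d(1,3-5) h'(4-6) in_HomD[OF q[OF h'(1)]] in_HomD[OF q[OF h'(2)]]
      in_HomD[OF s[OF c(1)]] in_HomD[OF s[OF d(1)]]
    have algs: "A \<in> Obj (alg_cat C M)" "B \<in> Obj (alg_cat C M)" using h'(1,2) Aeq Beq by simp_all
    have "?X h \<cdot> \<nu> (c, \<gamma>) = (?X h \<cdot> q (c, \<gamma>)) \<cdot> mult N c \<cdot> N.Ta (s c)"
      unfolding \<nu>_def by (simp add: types)
    also have "\<dots> = q (c', \<gamma>') \<cdot> (N.Ta h \<cdot> mult N c) \<cdot> N.Ta (s c)"
      unfolding q_nat[OF h, symmetric] by (simp add: types)
    also have "\<dots> = q (c', \<gamma>') \<cdot> mult N c' \<cdot> N.Ta (N.Ta h \<cdot> s c)"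
      unfolding N.mult_natural[OF h'(3), symmetric] by (simp add: types)
    also have "\<dots> = \<nu> (c', \<gamma>') \<cdot> N.Ta (?X h)"
      unfolding s_nat[OF h'(3), symmetric] \<nu>_def by (simp add: types)
    finally have "?X h \<cdot> \<nu> (c, \<gamma>) = \<nu> (c', \<gamma>') \<cdot> N.Ta (?X h)" .
    moreover have "is_algebra C N (L A)" "is_algebra C N (L B)"
      using univ[OF algs(1)] univ[OF algs(2)] by (simp_all add: universal_arrow_def)
    ultimately have l: "(L A, ?X h, L B) \<in> Hom (alg_cat C N) (L A) (L B)"
      using functor_Hom[OF X h'(3)] by (simp add: is_alg_morphism_def L_def Aeq Beq)
    have "?X h \<cdot> q (c, \<gamma>) \<cdot> eta N c = (?X h \<cdot> q (c, \<gamma>)) \<cdot> eta N c" by (simp add: types)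
    also have "\<dots> = q (c', \<gamma>') \<cdot> N.Ta h \<cdot> eta N c"
      unfolding q_nat[OF h, symmetric] by (simp add: types)
    also have "\<dots> = (q (c', \<gamma>') \<cdot> eta N c') \<cdot> h"
      unfolding N.eta_natural[OF h'(3), symmetric] by (simp add: types)
    finally have "on_arr (phi_star C \<phi>) (L A, ?X h, L B) \<cdot>\<^bsub>alg_cat C M\<^esub> u A = u B \<cdot>\<^bsub>alg_cat C M\<^esub> H"
      by (simp add: u_def Heq Aeq Beq)
    with K algs H l have "K B \<cdot>\<^bsub>alg_cat C N\<^esub> on_arr ?F H = (L A, ?X h, L B) \<cdot>\<^bsub>alg_cat C N\<^esub> K A"
      by blast
    moreover have "K A \<in> Hom (alg_cat C N) (on_obj ?F A) (L A)" "K B \<in> Hom (alg_cat C N) (on_obj ?F B) (L B)"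
      using K_iso algs by (simp_all add: is_iso_def)
    ultimately show ?thesis
      using functor_Hom[OF F H] by (auto simp: N.Hom_alg_cat \<kappa>_def Heq)
  qed
  have "nat_iso (alg_cat C M) C (forget \<odot> ?F) (X \<odot> forget) \<kappa>"
    unfolding nat_iso_def nat_trans_def
  proof (intro conjI allI ballI)
    fix A assume A: "A \<in> Obj (alg_cat C M)"
    show "is_iso C (on_obj (forget \<odot> ?F) A) (on_obj (X \<odot> forget) A) (\<kappa> A)" by (rule \<kappa>_iso[OF A])
    then show "\<kappa> A \<in> Hom C (on_obj (forget \<odot> ?F) A) (on_obj (X \<odot> forget) A)"
      by (simp only: is_iso_def)
  next
    fix A B H assume "H \<in> Hom (alg_cat C M) A B"
    then show "\<kappa> B \<cdot> on_arr (forget \<odot> ?F) H = on_arr (X \<odot> forget) H \<cdot> \<kappa> A" by (rule \<kappa>_nat)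
  qed
  then show ?thesis unfolding PBW_property_def using X by blast
qed

end

theorem theorem3p1:
  fixes C :: "('o, 'm) cat"
    and M N :: "('o, 'm) monad_data"
    and \<phi> :: "'o \<Rightarrow> 'm"
  assumes "category C"
    and "\<And>T. monad C T \<Longrightarrow> has_reflexive_coequalizers (alg_cat C T)"
    and "monad C M"
    and "monad C N"
    and "monad_morphism C M N \<phi>"
  shows "PBW_property C M N \<phi> \<longleftrightarrow> is_free_right_module C M (module_via C N \<phi>)"
proof -
  interpret monad_map C M N \<phi>
    using assms by unfold_locales
  have "has_reflexive_coequalizers (alg_cat C N)"
    by (rule assms(2)[OF assms(4)])
  then show ?thesis
    using free_if_PBW PBW_if_free by blast
qed

end
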